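(* Let $A_{G_2}=\begin{bmatrix}1&1\\1&0\end{bmatrix}$ and let $D_{G_2}^V=D_{A_{G_2}}$ be the Fibonacci-Dyck shift of vertex type. Its zeta function is $$\zeta_{D_{G_2}^V}(z)=\frac{1}{(2\xi(z)^2+\xi(z)-1)^2},$$ where $\xi(z)=\frac{2}{\sqrt3}\sin\Bigl(\frac13\arcsin\frac{3\sqrt3}{2}z\Bigr)$ for $0\le z\le\frac{2}{3\sqrt3}$.
   Context: Markov-Dyck shift of a matrix. Let $A=[A(i,j)]_{i,j=1}^{M}$ be a $\{0,1\}$-matrix with no zero row and no zero column. Let $\mathcal O_A$ be the Cuntz-Krieger algebra, i.e. the universal $C^*$-algebra generated by partial isometries $t_1,\dots,t_M$ subject to $\sum_{j=1}^M t_jt_j^*=1$ and $t_i^*t_i=\sum_{j=1}^M A(i,j)t_jt_j^*$ for $i=1,\dots,M$. Let $\Sigma=\{\alpha_1,\dots,\alpha_M\}\cup\{\beta_1,\dots,\beta_M\}$ (disjoint), and $\varphi_A(\alpha_i)=t_i^*$, $\varphi_A(\beta_i)=t_i$. A word $\gamma_1\cdots\gamma_n$ over $\Sigma$ is forbidden if $\varphi_A(\gamma_1)\cdots\varphi_A(\gamma_n)=0$ in $\mathcal O_A$. The Markov-Dyck shift $D_A\subset\Sigma^{\mathbb Z}$ is the subshift of all bi-infinite sequences containing no forbidden word. Here $G_2$ is the directed graph with vertices $1,2$, a loop at $1$, an edge from $1$ to $2$ and an edge from $2$ to $1$; $A_{G_2}$ is its vertex matrix. Zeta function. For a subshift $\Lambda$,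 $P_n(\Lambda)$ is the set of $x\in\Lambda$ with $\sigma^n(x)=x$ ($\sigma$ the left shift), and $\zeta_\Lambda(z)=\exp\bigl(\sum_{n\ge1}|P_n(\Lambda)|z^n/n\bigr)$. The identity for the zeta function is understood as an identity of power series at $z=0$ (equivalently, for all sufficiently small $z$, and by continuation of the power series beyond its disc of convergence). *)

theory Defs
  imports
    "HOL-Analysis.Analysis"
    "HOL-Library.Poly_Mapping"
    "HOL-Algebra.Ring"
begin

section \<open>The free unital *-algebra on a set of generators\<close>

datatype 'g gen = Gen 'g | Adj 'g

datatype 'g gen_word = Word "'g gen list"

text \<open>
  Words form the free monoid, written additively because the convolution product of
  \<^typ>\<open>'k \<Rightarrow>\<^sub>0 'r\<close> is available for exponents in \<^class>\<open>monoid_add\<close>.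
\<close>

instantiation gen_word :: (type) monoid_add
begin

definition zero_gen_word :: "'a gen_word" where
  "zero_gen_word = Word []"

fun plus_gen_word :: "'a gen_word \<Rightarrow> 'a gen_word \<Rightarrow> 'a gen_word" where
  "plus_gen_word (Word u) (Word v) = Word (u @ v)"

instance
proof
  fix a b c :: "'a gen_word"
  show "a + b + c = a + (b + c)" by (cases a; cases b; cases c) simp
  show "0 + a = a" by (cases a) (simp add: zero_gen_word_def)
  show "a + 0 = a" by (cases a) (simp add: zero_gen_word_def)
qed

end

type_synonym 'g fsa = "'g gen_word \<Rightarrow>\<^sub>0 complex"

fun gen_star :: "'g gen \<Rightarrow> 'g gen" where
  "gen_star (Gen g) = Adj g"
| "gen_star (Adj g) = Gen g"

fun word_star :: "'g gen_word \<Rightarrow> 'g gen_word" where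
  "word_star (Word w) = Word (rev (map gen_star w))"

definition fsa_gen :: "'g \<Rightarrow> 'g fsa" where
  "fsa_gen g = Poly_Mapping.single (Word [Gen g]) 1"

definition fsa_star :: "'g fsa \<Rightarrow> 'g fsa" where
  "fsa_star p = (\<Sum>w\<in>Poly_Mapping.keys p.
     Poly_Mapping.single (word_star w) (cnj (Poly_Mapping.lookup p w)))"

definition fsa_scale :: "complex \<Rightarrow> 'g fsa \<Rightarrow> 'g fsa" where
  "fsa_scale c p = Poly_Mapping.single 0 c * p"


section \<open>The universal C*-algebra of a set of relations\<close>

text \<open>
  The set \<open>R\<close> consists of the elements of the free *-algebra that are to vanish. A *-homomorphism
  \<open>\<pi>\<close> from the free *-algebra into some C*-algebra that kills \<open>R\<close> induces the C*-seminorm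
  \<open>p \<mapsto> \<parallel>\<pi> p\<parallel>\<close> vanishing on \<open>R\<close>; conversely every such C*-seminorm arises in this way, from the
  Hausdorff completion. The universal C*-algebra is the Hausdorff completion with respect to the
  supremum of these C*-seminorms, so that no quantification over all C*-algebras is needed.
\<close>

definition cstar_seminorm :: "('g fsa \<Rightarrow> real) \<Rightarrow> bool" where
  "cstar_seminorm q \<longleftrightarrow>
     (\<forall>p. 0 \<le> q p) \<and>
     (\<forall>p r. q (p + r) \<le> q p + q r) \<and>
     (\<forall>c p. q (fsa_scale c p) = cmod c * q p) \<and>
     (\<forall>p r. q (p * r) \<le> q p * q r) \<and>
     (\<forall>p. q (fsa_star p * p) = (q p)\<^sup>2)"

text \<open>
  The supremum is meaningful only if it is finite for each \<open>p\<close>, as is usual for universal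
  C*-algebras. It is finite whenever the relations force the generators to be partial isometries,
  which have norm at most \<open>1\<close>.
\<close>

definition univ_norm :: "'g fsa set \<Rightarrow> 'g fsa \<Rightarrow> real" where
  "univ_norm R p = (SUP q\<in>{q. cstar_seminorm q \<and> (\<forall>r\<in>R. q r = 0)}. q p)"

definition univ_Cauchy :: "'g fsa set \<Rightarrow> (nat \<Rightarrow> 'g fsa) \<Rightarrow> bool" where
  "univ_Cauchy R X \<longleftrightarrow> (\<forall>e>0. \<exists>N. \<forall>m\<ge>N. \<forall>n\<ge>N. univ_norm R (X m - X n) < e)"

definition univ_rel :: "'g fsa set \<Rightarrow> ((nat \<Rightarrow> 'g fsa) \<times> (nat \<Rightarrow> 'g fsa)) set" where
  "univ_rel R = {(X, Y). univ_Cauchy R X \<and> univ_Cauchy R Y \<and>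
     (\<lambda>n. univ_norm R (X n - Y n)) \<longlonglongrightarrow> 0}"

record 'a cstar_alg = "'a ring" +
  scale :: "complex \<Rightarrow> 'a \<Rightarrow> 'a"
  star :: "'a \<Rightarrow> 'a"
  cnorm :: "'a \<Rightarrow> real"

definition universal_cstar :: "'g fsa set \<Rightarrow> (nat \<Rightarrow> 'g fsa) set cstar_alg" where
  "universal_cstar R = \<lparr>
     carrier = {X. univ_Cauchy R X} // univ_rel R,
     mult = (\<lambda>x y. \<Union>X\<in>x. \<Union>Y\<in>y. univ_rel R `` {\<lambda>n. X n * Y n}),
     one = univ_rel R `` {\<lambda>n. 1},
     zero = univ_rel R `` {\<lambda>n. 0},
     add = (\<lambda>x y. \<Union>X\<in>x. \<Union>Y\<in>y. univ_rel R `` {\<lambda>n. X n + Y n}),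
     scale = (\<lambda>c x. \<Union>X\<in>x. univ_rel R `` {\<lambda>n. fsa_scale c (X n)}),
     star = (\<lambda>x. \<Union>X\<in>x. univ_rel R `` {\<lambda>n. fsa_star (X n)}),
     cnorm = (\<lambda>x. the_elem ((\<lambda>X. lim (\<lambda>n. univ_norm R (X n))) ` x)) \<rparr>"

definition universal_gen :: "'g fsa set \<Rightarrow> 'g \<Rightarrow> (nat \<Rightarrow> 'g fsa) set" where
  "universal_gen R g = univ_rel R `` {\<lambda>n. fsa_gen g}"


section \<open>Cuntz-Krieger algebras\<close>

text \<open>
  The matrix \<open>A\<close> is meant to have entries in \<open>{0, 1}\<close> and no zero row or column; the definitions
  make sense for all \<open>A\<close>.
\<close>

definition ck_relators :: "nat ^ 'n ^ 'n \<Rightarrow> 'n::finite fsa set" where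
  "ck_relators A =
     {fsa_gen i * fsa_star (fsa_gen i) * fsa_gen i - fsa_gen i | i. True} \<union>
     {(\<Sum>j\<in>UNIV. fsa_gen j * fsa_star (fsa_gen j)) - 1} \<union>
     {fsa_star (fsa_gen i) * fsa_gen i
        - (\<Sum>j\<in>UNIV. of_nat (A $ i $ j) * (fsa_gen j * fsa_star (fsa_gen j))) | i. True}"

definition cuntz_krieger :: "nat ^ 'n ^ 'n \<Rightarrow> (nat \<Rightarrow> 'n::finite fsa) set cstar_alg" where
  "cuntz_krieger A = universal_cstar (ck_relators A)"

definition ck_gen :: "nat ^ 'n ^ 'n \<Rightarrow> 'n \<Rightarrow> (nat \<Rightarrow> 'n::finite fsa) set" where
  "ck_gen A i = universal_gen (ck_relators A) i"


section \<open>Markov-Dyck shifts\<close>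

datatype 'n letter = Alpha 'n | Beta 'n

fun ck_letter :: "nat ^ 'n ^ 'n \<Rightarrow> 'n letter \<Rightarrow> (nat \<Rightarrow> 'n::finite fsa) set" where
  "ck_letter A (Alpha i) = star (cuntz_krieger A) (ck_gen A i)"
| "ck_letter A (Beta i) = ck_gen A i"

definition ck_word :: "nat ^ 'n ^ 'n \<Rightarrow> 'n letter list \<Rightarrow> (nat \<Rightarrow> 'n::finite fsa) set" where
  "ck_word A w =
     foldr (mult (cuntz_krieger A)) (map (ck_letter A) w) \<one>\<^bsub>cuntz_krieger A\<^esub>"

definition forbidden :: "nat ^ 'n ^ 'n \<Rightarrow> 'n::finite letter list \<Rightarrow> bool" where
  "forbidden A w \<longleftrightarrow> ck_word A w = \<zero>\<^bsub>cuntz_krieger A\<^esub>"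

definition markov_dyck_shift :: "nat ^ 'n ^ 'n \<Rightarrow> (int \<Rightarrow> 'n::finite letter) set" where
  "markov_dyck_shift A =
     {x. \<forall>k n. \<not> forbidden A (map (\<lambda>j. x (k + int j)) [0..<n])}"

definition A_G2 :: "nat ^ 2 ^ 2" where
  "A_G2 = vector [vector [1, 1], vector [1, 0]]"


section \<open>Zeta functions of subshifts\<close>

definition left_shift :: "(int \<Rightarrow> 'a) \<Rightarrow> int \<Rightarrow> 'a" where
  "left_shift x = (\<lambda>k. x (k + 1))"

definition periodic_pts :: "(int \<Rightarrow> 'a) set \<Rightarrow> nat \<Rightarrow> (int \<Rightarrow> 'a) set" where
  "periodic_pts L n = {x \<in> L. (left_shift ^^ n) x = x}"

text \<open>
  Over a finite alphabet, \<^term>\<open>periodic_pts L n\<close> is finite for \<open>n > 0\<close>, so \<^const>\<open>card\<close> is the true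
  number of points.
\<close>

definition zeta_series :: "(int \<Rightarrow> 'a) set \<Rightarrow> real fps" where
  "zeta_series L = fps_compose (fps_exp 1)
     (Abs_fps (\<lambda>n. if n = 0 then 0 else real (card (periodic_pts L n)) / real n))"

text \<open>
  Relevant for \<open>\<bar>z\<bar> \<le> 2 / (3 * sqrt 3)\<close>, where the argument of \<^const>\<open>arcsin\<close> lies in \<open>[-1, 1]\<close>.
\<close>

definition xi :: "real \<Rightarrow> real" where
  "xi z = 2 / sqrt 3 * sin (1 / 3 * arcsin (3 * sqrt 3 / 2 * z))"

end

theory Submission
  imports Defs
begin

text \<open>
  The algebra \<open>\<O>\<^sub>A\<close> of the Fibonacci matrix is represented on \<open>\<ell>\<^sup>2(\<nat>)\<close> by \<open>t\<^sub>1 e\<^sub>x = e\<^bsub>2x\<^esub>\<close>,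
  \<open>t\<^sub>2 e\<^bsub>2x\<^esub> = e\<^bsub>2x+1\<^esub>\<close> and \<open>t\<^sub>2 e\<^bsub>2x+1\<^esub> = 0\<close>, so every word acts as a partial injection of \<open>\<nat>\<close>.
  In the other direction, \<open>t\<^sub>1\<^sup>* t\<^sub>1 = 1\<close>, \<open>t\<^sub>2\<^sup>* t\<^sub>2 = t\<^sub>1 t\<^sub>1\<^sup>*\<close>, \<open>t\<^sub>i\<^sup>* t\<^sub>j = 0\<close> for \<open>i \<noteq> j\<close> and
  \<open>t\<^sub>2 t\<^sub>2 = 0\<close> reduce each word either to \<open>0\<close> or to a normal form \<open>\<beta>\<^sub>m e \<alpha>\<^sub>n\<close>, where \<open>m\<close> and \<open>n\<close> are
  lists of indices without two adjacent 2s and \<open>e\<close> is \<open>1\<close> or \<open>t\<^sub>1 t\<^sub>1\<^sup>*\<close>. Normal forms act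
  non-trivially, hence a word is forbidden iff it acts on \<open>\<nat>\<close> as the empty map
  (\<open>forbidden_G2_iff\<close>).

  A point of period \<open>N\<close> is thus a word \<open>w\<close> of length \<open>N\<close> all of whose powers have a normal form.
  This holds as soon as \<open>w w\<close> has one, and it can be read off from the normal form
  \<open>\<beta>\<^sub>m e \<alpha>\<^sub>n\<close> of \<open>w\<close>: one of \<open>m\<close> and \<open>rev n\<close> is a prefix of the other, and the rest \<open>k\<close> of the
  longer one can be repeated, with a condition on its first entry if \<open>e\<close> is \<open>t\<^sub>1 t\<^sub>1\<^sup>*\<close>
  (\<open>recurrent_if_square\<close>, \<open>act_power_if_recurrent\<close>).

  The words are counted by normal form. Let \<open>E = 1 + z\<^sup>2 E\<^sup>3\<close> as a power series. The words with normal
  form \<open>\<beta>\<^sub>m e \<alpha>\<^sub>n\<close> have as generating function a product with a factor \<open>z E\<^sup>2\<close> for each index 1 in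
  \<open>m\<close> and \<open>n\<close>, a factor \<open>z E\<close> for each index 2, and a factor \<open>E\<close> or \<open>E\<^sup>2 - E\<close> for \<open>e\<close>
  (\<open>nf_count_eq\<close>); one only has to check that these products satisfy the recursion obtained by
  prepending a letter. The series \<open>\<xi> = z E\<close> solves \<open>\<xi> - \<xi>\<^sup>3 = z\<close>, and summing over the recurrent
  normal forms (\<open>recurrent_nfs_sum\<close>) gives an expression for \<open>P = \<Sum> |P\<^sub>N| z\<^sup>N\<close> that is rational
  in \<open>\<xi>\<close>. It simplifies to
    \<open>(P - 1) (1 - 3\<xi>\<^sup>2) (1 - \<xi> - 2\<xi>\<^sup>2) = 2z (1 + 4\<xi>)\<close>,
  where the constant term 1 of \<open>P\<close> comes from the empty word.

  Since \<open>\<xi>' (1 - 3\<xi>\<^sup>2) = 1\<close>, this says that \<open>(P - 1) / z\<close>, the logarithmic derivative of the zeta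
  function, is that of \<open>(1 - \<xi> - 2\<xi>\<^sup>2)\<^bsup>-2\<^esup>\<close> (\<open>zeta_series_eq\<close>). Finally, by the formula for
  \<open>sin (3t)\<close>, the trigonometric function in the statement also solves \<open>\<xi> - \<xi>\<^sup>3 = z\<close>, and
  near 0 there is only one small solution (\<open>xi_has_fps_expansion\<close>).
\<close>

section \<open>The free *-algebra\<close>

lemma gen_star_gen_star [simp]: "gen_star (gen_star g) = g"
  by (cases g) auto

lemma word_star_word_star [simp]: "word_star (word_star w) = w"
  by (cases w) (simp add: rev_map o_def)

lemma word_star_plus: "word_star (u + v) = word_star v + word_star u"
  by (cases u; cases v) simp

lemma word_star_zero [simp]: "word_star 0 = 0"
  by (simp add: zero_gen_word_def)

lemma fsa_induct [case_names single add]: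
  assumes single: "\<And>w c. P (Poly_Mapping.single w c)"
    and add: "\<And>p r. P p \<Longrightarrow> P r \<Longrightarrow> P (p + r)"
  shows "P (p :: 'g fsa)"
proof (induction p rule: update_induct)
  case const
  show ?case using single[of 0 0] by simp
next
  case (update p w c)
  have "Poly_Mapping.update w c p = p + Poly_Mapping.single w c"
    using update.hyps
    by (intro poly_mapping_eqI)
      (auto simp: lookup_update lookup_add lookup_single when_def in_keys_iff)
  then show ?case using update single add by simp
qed

lemma lookup_fsa_star:
  "Poly_Mapping.lookup (fsa_star p) w = cnj (Poly_Mapping.lookup p (word_star w))"
proof -
  have eq: "word_star v = w \<longleftrightarrow> v = word_star w" for v :: "'a gen_word"
    by auto
  show ?thesis
    by (simp add: fsa_star_def lookup_sum lookup_single when_def eq in_keys_iff)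
qed

lemma fsa_star_fsa_star [simp]: "fsa_star (fsa_star p) = p"
  by (rule poly_mapping_eqI) (simp add: lookup_fsa_star)

lemma fsa_star_add: "fsa_star (p + r) = fsa_star p + fsa_star r"
  by (rule poly_mapping_eqI) (simp add: lookup_fsa_star lookup_add)

lemma fsa_star_single:
  "fsa_star (Poly_Mapping.single w c) = Poly_Mapping.single (word_star w) (cnj c)"
  by (rule poly_mapping_eqI) (auto simp: lookup_fsa_star lookup_single when_def)

lemma fsa_star_mult: "fsa_star (p * r) = fsa_star r * fsa_star p"
proof (induction p rule: fsa_induct)
  case (single u c)
  show ?case
  proof (induction r rule: fsa_induct)
    case (single v d)
    show ?case by (simp add: mult_single fsa_star_single word_star_plus mult.commute)
  qed (simp add: fsa_star_add algebra_simps)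
qed (simp add: fsa_star_add algebra_simps)

lemma fsa_star_one [simp]: "fsa_star 1 = 1"
  using fsa_star_single[of 0 1] by simp

lemma fsa_scale_scale: "fsa_scale c (fsa_scale d p) = fsa_scale (c * d) p"
  by (simp add: fsa_scale_def mult_single flip: mult.assoc)

lemma fsa_scale_one: "fsa_scale 1 p = p"
  by (simp add: fsa_scale_def)

section \<open>C*-seminorms\<close>

context
  fixes q :: "'g fsa \<Rightarrow> real"
  assumes q: "cstar_seminorm q"
begin

lemma cstar_nonneg: "0 \<le> q p"
  and cstar_triangle: "q (p + r) \<le> q p + q r"
  and cstar_scale: "q (fsa_scale c p) = cmod c * q p"
  and cstar_submult: "q (p * r) \<le> q p * q r"
  and cstar_identity: "q (fsa_star p * p) = (q p)\<^sup>2"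
  using q by (auto simp: cstar_seminorm_def)

lemma cstar_zero: "q 0 = 0"
  using cstar_scale[of 0 0] by (simp add: fsa_scale_def)

lemma cstar_minus: "q (- p) = q p"
proof -
  have "fsa_scale (- 1) p = - p"
    by (simp add: fsa_scale_def single_uminus)
  then show ?thesis using cstar_scale[of "- 1" p] by simp
qed

lemma cstar_minus_commute: "q (p - r) = q (r - p)"
  using cstar_minus[of "p - r"] by simp

lemma cstar_star: "q (fsa_star p) = q p"
proof -
  have le: "q r \<le> q (fsa_star r)" for r
  proof (cases "q r = 0")
    case False
    have "q r * q r \<le> q (fsa_star r) * q r"
      using cstar_identity[of r] cstar_submult[of "fsa_star r" r] by (simp add: power2_eq_square)
    then show ?thesis using False cstar_nonneg[of r] by simp
  qed (simp add: cstar_nonneg)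
  show ?thesis using le[of p] le[of "fsa_star p"] by simp
qed

lemma cstar_null_mult:
  assumes "q p = 0 \<or> q r = 0"
  shows "q (p * r) = 0"
proof -
  have "q (p * r) \<le> 0"
    using cstar_submult[of p r] assms by auto
  then show ?thesis using cstar_nonneg[of "p * r"] by simp
qed

lemma cstar_null_add:
  assumes "q p = 0" "q r = 0"
  shows "q (p + r) = 0"
  using cstar_triangle[of p r] cstar_nonneg[of "p + r"] assms by simp

lemma cstar_null_diff:
  assumes "q (p - r) = 0"
  shows "q p = q r"
proof -
  have "q p \<le> q (p - r) + q r" "q r \<le> q (r - p) + q p"
    using cstar_triangle[of "p - r" r] cstar_triangle[of "r - p" p] by simp_all
  then show ?thesis using assms cstar_minus_commute[of p r] by simp
qed

lemma cstar_one_le: "q 1 \<le> 1"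
proof -
  have "q 1 * (q 1 - 1) = 0"
    using cstar_identity[of 1] by (simp add: power2_eq_square algebra_simps)
  then show ?thesis by auto
qed

text \<open>
  For \<open>s = t\<^sup>* t\<close> the C*-identity gives \<open>q (s\<^sup>* s) = q(s)\<^sup>2\<close>, and \<open>s\<^sup>* s\<close> agrees with \<open>s\<close> up
  to an element that \<open>q\<close> kills. Hence \<open>q s\<close> is \<open>0\<close> or \<open>1\<close>.
\<close>

lemma cstar_partial_isometry_le:
  assumes "q (t * fsa_star t * t - t) = 0"
  shows "q t \<le> 1"
proof -
  define s where "s = fsa_star t * t"
  have "s * s - s = fsa_star t * (t * fsa_star t * t - t)"
    by (simp add: s_def algebra_simps)
  then have "q (s * s) = q s"
    using assms cstar_null_mult cstar_null_diff by metis
  moreover have "fsa_star s = s"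
    by (simp add: s_def fsa_star_mult)
  ultimately have "q s * (q s - 1) = 0"
    using cstar_identity[of s] by (simp add: power2_eq_square algebra_simps)
  moreover have "q s = (q t)\<^sup>2"
    by (simp add: s_def cstar_identity)
  ultimately have "(q t)\<^sup>2 \<le> 1\<^sup>2" by auto
  then show ?thesis using cstar_nonneg[of t] by (simp add: power2_le_imp_le[of _ 1])
qed

lemma cstar_word_le:
  assumes "\<And>g. q (fsa_gen g) \<le> 1"
  shows "q (Poly_Mapping.single (Word w) 1) \<le> 1"
proof (induction w)
  case Nil
  show ?case using cstar_one_le by (simp flip: zero_gen_word_def)
next
  case (Cons l w)
  have l: "q (Poly_Mapping.single (Word [l]) 1) \<le> 1"
  proof (cases l)
    case (Gen g)
    then show ?thesis using assms[of g] by (simp add: fsa_gen_def)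
  next
    case (Adj g)
    then have "Poly_Mapping.single (Word [l]) 1 = fsa_star (fsa_gen g)"
      by (simp add: fsa_gen_def fsa_star_single)
    then show ?thesis using assms[of g] by (simp add: cstar_star)
  qed
  have "Poly_Mapping.single (Word (l # w)) 1 =
      Poly_Mapping.single (Word [l]) (1::complex) * Poly_Mapping.single (Word w) 1"
    by (simp add: mult_single)
  then have "q (Poly_Mapping.single (Word (l # w)) 1)
      \<le> q (Poly_Mapping.single (Word [l]) 1) * q (Poly_Mapping.single (Word w) 1)"
    by (simp add: cstar_submult)
  also have "\<dots> \<le> 1"
    using l Cons cstar_nonneg by (intro mult_le_one)
  finally show ?case .
qed

end

text \<open>
  Each word has seminorm at most 1, so the sum of the absolute values of the coefficients
  bounds all these seminorms at once. This makes the supremum in \<^const>\<open>univ_norm\<close> finite.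
\<close>

lemma cstar_seminorm_uniform_bound:
  "\<exists>B. \<forall>q. cstar_seminorm q \<longrightarrow> (\<forall>g. q (fsa_gen g) \<le> 1) \<longrightarrow> q p \<le> B"
proof (induction p rule: fsa_induct)
  case (single w c)
  obtain v where w: "w = Word v" by (cases w)
  have "Poly_Mapping.single w c = fsa_scale c (Poly_Mapping.single (Word v) 1)"
    by (simp add: w fsa_scale_def mult_single)
  then have "q (Poly_Mapping.single w c) \<le> cmod c"
    if "cstar_seminorm q" "\<forall>g. q (fsa_gen g) \<le> 1" for q
    using that cstar_word_le[of q v] by (simp add: cstar_scale mult_left_le)
  then show ?case by blast
next
  case (add p r)
  then show ?case by (meson add_mono cstar_triangle order_trans)
qed

section \<open>The universal C*-algebra\<close>

abbreviation null_seminorms :: "'g fsa set \<Rightarrow> ('g fsa \<Rightarrow> real) set" where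
  "null_seminorms R \<equiv> {q. cstar_seminorm q \<and> (\<forall>r\<in>R. q r = 0)}"

lemma zero_in_null_seminorms: "(\<lambda>p. 0) \<in> null_seminorms R"
  by (simp add: cstar_seminorm_def)

context
  fixes R :: "'g fsa set"
  assumes gen_le: "\<forall>q \<in> null_seminorms R. \<forall>g. q (fsa_gen g) \<le> 1"
begin

lemma univ_norm_upper:
  assumes "q \<in> null_seminorms R"
  shows "q p \<le> univ_norm R p"
proof -
  have "bdd_above ((\<lambda>q. q p) ` null_seminorms R)"
    using cstar_seminorm_uniform_bound[of p] gen_le by (fastforce simp: bdd_above_def)
  then show ?thesis
    unfolding univ_norm_def using assms by (rule cSUP_upper[rotated])
qed

lemma univ_norm_least:
  assumes "\<And>q. q \<in> null_seminorms R \<Longrightarrow> q p \<le> B"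
  shows "univ_norm R p \<le> B"
  unfolding univ_norm_def
  using zero_in_null_seminorms[of R] assms by (intro cSUP_least) blast+

lemma univ_norm_nonneg: "0 \<le> univ_norm R p"
  using univ_norm_upper[OF zero_in_null_seminorms] by simp

text \<open>
  The pointwise supremum of C*-seminorms, when it is finite, is again a C*-seminorm. So the
  universal norm can be treated like a single one.
\<close>

lemma cstar_seminorm_univ_norm: "cstar_seminorm (univ_norm R)"
proof -
  have scale_le: "univ_norm R (fsa_scale c p) \<le> cmod c * univ_norm R p" for c p
    by (rule univ_norm_least) (auto simp: cstar_scale intro!: mult_left_mono univ_norm_upper)
  have scale_ge: "cmod c * univ_norm R p \<le> univ_norm R (fsa_scale c p)" for c p
  proof (cases "c = 0")
    case False
    then have "univ_norm R p \<le> cmod (inverse c) * univ_norm R (fsa_scale c p)"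
      using scale_le[of "inverse c" "fsa_scale c p"] by (simp add: fsa_scale_scale fsa_scale_one)
    then show ?thesis using False by (simp add: norm_inverse norm_divide field_simps)
  qed (simp add: univ_norm_nonneg)
  have "univ_norm R (p + r) \<le> univ_norm R p + univ_norm R r" for p r
    by (rule univ_norm_least)
      (auto intro: order_trans[OF cstar_triangle add_mono[OF univ_norm_upper univ_norm_upper]])
  moreover have "univ_norm R (p * r) \<le> univ_norm R p * univ_norm R r" for p r
    by (rule univ_norm_least)
      (auto intro!: order_trans[OF cstar_submult mult_mono[OF univ_norm_upper univ_norm_upper]]
        simp: univ_norm_nonneg cstar_nonneg)
  moreover have "univ_norm R (fsa_star p * p) \<le> (univ_norm R p)\<^sup>2" for p
    by (rule univ_norm_least)
      (auto simp: cstar_identity cstar_nonneg intro!: power_mono univ_norm_upper)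
  moreover have "(univ_norm R p)\<^sup>2 \<le> univ_norm R (fsa_star p * p)" for p
  proof -
    have "univ_norm R p \<le> sqrt (univ_norm R (fsa_star p * p))"
    proof (rule univ_norm_least)
      fix q assume q: "q \<in> null_seminorms R"
      then have "(q p)\<^sup>2 \<le> univ_norm R (fsa_star p * p)"
        using univ_norm_upper[OF q, of "fsa_star p * p"] by (simp add: cstar_identity)
      then show "q p \<le> sqrt (univ_norm R (fsa_star p * p))"
        by (rule real_le_rsqrt)
    qed
    then show ?thesis
      using univ_norm_nonneg[of p] univ_norm_nonneg[of "fsa_star p * p"]
      by (metis power_mono real_sqrt_pow2)
  qed
  ultimately show ?thesis
    unfolding cstar_seminorm_def
    by (auto intro!: antisym univ_norm_nonneg scale_le scale_ge)
qed

text \<open>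
  The image of an element of the free *-algebra in its Hausdorff completion.
\<close>

abbreviation const_class :: "'g fsa \<Rightarrow> (nat \<Rightarrow> 'g fsa) set" where
  "const_class p \<equiv> univ_rel R `` {\<lambda>n. p}"

lemma univ_Cauchy_if_tendsto:
  assumes "(\<lambda>n. univ_norm R (p - X n)) \<longlonglongrightarrow> 0"
  shows "univ_Cauchy R X"
  unfolding univ_Cauchy_def
proof (intro allI impI)
  fix e :: real assume "e > 0"
  then obtain N where N: "\<And>n. n \<ge> N \<Longrightarrow> univ_norm R (p - X n) < e / 2"
    using order_tendstoD(2)[OF assms, of "e / 2"] by (auto simp: eventually_sequentially)
  have "univ_norm R (X m - X n) < e" if "m \<ge> N" "n \<ge> N" for m n
  proof -
    have "univ_norm R (X m - X n) \<le> univ_norm R (X m - p) + univ_norm R (p - X n)"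
      using cstar_triangle[OF cstar_seminorm_univ_norm, of "X m - p" "p - X n"] by simp
    then show ?thesis
      using N[OF that(1)] N[OF that(2)]
        cstar_minus_commute[OF cstar_seminorm_univ_norm, of "X m" p] by simp
  qed
  then show "\<exists>N. \<forall>m\<ge>N. \<forall>n\<ge>N. univ_norm R (X m - X n) < e" by blast
qed

lemma const_class_eq: "const_class p = {X. (\<lambda>n. univ_norm R (p - X n)) \<longlonglongrightarrow> 0}"
proof -
  have "univ_Cauchy R (\<lambda>n. p)"
    by (simp add: univ_Cauchy_def cstar_zero[OF cstar_seminorm_univ_norm])
  then show ?thesis
    by (auto simp: univ_rel_def univ_Cauchy_if_tendsto)
qed

lemma univ_rel_class_eq:
  assumes "X \<in> const_class p"
  shows "univ_rel R `` {X} = const_class p"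
proof -
  note U = cstar_seminorm_univ_norm
  have X: "(\<lambda>n. univ_norm R (p - X n)) \<longlonglongrightarrow> 0"
    using assms by (simp add: const_class_eq)
  have "(\<lambda>n. univ_norm R (X n - Y n)) \<longlonglongrightarrow> 0 \<longleftrightarrow> (\<lambda>n. univ_norm R (p - Y n)) \<longlonglongrightarrow> 0" for Y
  proof
    assume Y: "(\<lambda>n. univ_norm R (X n - Y n)) \<longlonglongrightarrow> 0"
    have "univ_norm R (p - Y n) \<le> univ_norm R (p - X n) + univ_norm R (X n - Y n)" for n
      using cstar_triangle[OF U, of "p - X n" "X n - Y n"] by simp
    then show "(\<lambda>n. univ_norm R (p - Y n)) \<longlonglongrightarrow> 0"
      by (intro Lim_null_comparison[OF always_eventually tendsto_add_zero[OF X Y]])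
        (simp add: univ_norm_nonneg)
  next
    assume Y: "(\<lambda>n. univ_norm R (p - Y n)) \<longlonglongrightarrow> 0"
    have "univ_norm R (X n - Y n) \<le> univ_norm R (p - X n) + univ_norm R (p - Y n)" for n
      using cstar_triangle[OF U, of "X n - p" "p - Y n"] cstar_minus_commute[OF U, of "X n" p]
      by simp
    then show "(\<lambda>n. univ_norm R (X n - Y n)) \<longlonglongrightarrow> 0"
      by (intro Lim_null_comparison[OF always_eventually tendsto_add_zero[OF X Y]])
        (simp add: univ_norm_nonneg)
  qed
  then show ?thesis
    using univ_Cauchy_if_tendsto[OF X] unfolding const_class_eq
    by (auto simp: univ_rel_def intro: univ_Cauchy_if_tendsto)
qed

lemma const_in_const_class: "(\<lambda>n. p) \<in> const_class p"
  by (simp add: const_class_eq cstar_zero[OF cstar_seminorm_univ_norm])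

lemma const_class_eq_iff: "const_class p = const_class r \<longleftrightarrow> univ_norm R (p - r) = 0"
proof
  assume "const_class p = const_class r"
  then have "(\<lambda>n. r) \<in> const_class p" using const_in_const_class by simp
  then show "univ_norm R (p - r) = 0" by (simp add: const_class_eq LIMSEQ_const_iff)
next
  assume "univ_norm R (p - r) = 0"
  then have "(\<lambda>n. r) \<in> const_class p" by (simp add: const_class_eq)
  then show "const_class p = const_class r" using univ_rel_class_eq by blast
qed

text \<open>
  The operations of the completion are unions over all representatives. They collapse to one
  class because a product of sequences that tend to \<open>p\<close> and \<open>r\<close> tends to \<open>p * r\<close>.
\<close>

lemma mult_const_class:
  "mult (universal_cstar R) (const_class p) (const_class r) = const_class (p * r)"
proof -
  note U = cstar_seminorm_univ_norm
  have "(\<lambda>n. X n * Y n) \<in> const_class (p * r)"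
    if "X \<in> const_class p" "Y \<in> const_class r" for X Y
  proof -
    let ?b = "\<lambda>n. univ_norm R (p - X n) * univ_norm R r
      + (univ_norm R p + univ_norm R (p - X n)) * univ_norm R (r - Y n)"
    have X: "(\<lambda>n. univ_norm R (p - X n)) \<longlonglongrightarrow> 0" and Y: "(\<lambda>n. univ_norm R (r - Y n)) \<longlonglongrightarrow> 0"
      using that by (simp_all add: const_class_eq)
    have "?b \<longlonglongrightarrow> 0 * univ_norm R r + (univ_norm R p + 0) * 0"
      by (intro tendsto_intros X Y)
    then have lim: "?b \<longlonglongrightarrow> 0" by simp
    have bound: "univ_norm R (p * r - X n * Y n) \<le> ?b n" for n
    proof -
      have "p * r - X n * Y n = (p - X n) * r + X n * (r - Y n)"
        by (simp add: algebra_simps)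
      then have "univ_norm R (p * r - X n * Y n)
          \<le> univ_norm R (p - X n) * univ_norm R r + univ_norm R (X n) * univ_norm R (r - Y n)"
        using cstar_triangle[OF U, of "(p - X n) * r" "X n * (r - Y n)"]
          cstar_submult[OF U, of "p - X n" r] cstar_submult[OF U, of "X n" "r - Y n"] by simp
      moreover have "univ_norm R (X n) \<le> univ_norm R p + univ_norm R (p - X n)"
        using cstar_triangle[OF U, of p "X n - p"] cstar_minus_commute[OF U, of "X n" p] by simp
      ultimately show ?thesis
        using mult_right_mono[OF _ univ_norm_nonneg] by (smt (verit))
    qed
    show ?thesis
      unfolding const_class_eq mem_Collect_eq using bound
      by (intro Lim_null_comparison[OF always_eventually lim]) (simp add: univ_norm_nonneg)
  qed
  then have "univ_rel R `` {\<lambda>n. X n * Y n} = const_class (p * r)"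
    if "X \<in> const_class p" "Y \<in> const_class r" for X Y
    using that univ_rel_class_eq by blast
  moreover have "const_class p \<noteq> {}" "const_class r \<noteq> {}"
    using const_in_const_class by blast+
  ultimately show ?thesis by (simp add: universal_cstar_def)
qed

lemma star_const_class: "star (universal_cstar R) (const_class p) = const_class (fsa_star p)"
proof -
  note U = cstar_seminorm_univ_norm
  have diff: "fsa_star p - fsa_star r = fsa_star (p - r)" for r
    by (rule poly_mapping_eqI) (simp add: lookup_fsa_star lookup_minus)
  have "(\<lambda>n. fsa_star (X n)) \<in> const_class (fsa_star p)" if "X \<in> const_class p" for X
    using that by (simp add: const_class_eq diff cstar_star[OF U])
  then have "univ_rel R `` {\<lambda>n. fsa_star (X n)} = const_class (fsa_star p)"
    if "X \<in> const_class p" for X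
    using that univ_rel_class_eq by blast
  moreover have "const_class p \<noteq> {}"
    using const_in_const_class by blast
  ultimately show ?thesis by (simp add: universal_cstar_def)
qed

end

lemma one_universal_cstar: "one (universal_cstar R) = univ_rel R `` {\<lambda>n. 1}"
  and zero_universal_cstar: "zero (universal_cstar R) = univ_rel R `` {\<lambda>n. 0}"
  by (simp_all add: universal_cstar_def)

section \<open>Forbidden words\<close>

fun letter_fsa :: "'n letter \<Rightarrow> 'n fsa" where
  "letter_fsa (Alpha i) = fsa_star (fsa_gen i)"
| "letter_fsa (Beta i) = fsa_gen i"

definition word_fsa :: "'n letter list \<Rightarrow> 'n fsa" where
  "word_fsa w = prod_list (map letter_fsa w)"

lemma ck_gen_norm_le: "\<forall>q \<in> null_seminorms (ck_relators A). \<forall>i. q (fsa_gen i) \<le> 1"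
  by (auto intro!: cstar_partial_isometry_le simp: ck_relators_def)

lemma ck_word_eq: "ck_word A w = univ_rel (ck_relators A) `` {\<lambda>n. word_fsa w}"
proof (induction w)
  case Nil
  show ?case by (simp add: ck_word_def word_fsa_def cuntz_krieger_def one_universal_cstar)
next
  case (Cons l w)
  have "ck_letter A l = univ_rel (ck_relators A) `` {\<lambda>n. letter_fsa l}"
    by (cases l)
      (simp_all add: ck_gen_def universal_gen_def cuntz_krieger_def
        star_const_class[OF ck_gen_norm_le])
  moreover have "ck_word A (l # w) = mult (cuntz_krieger A) (ck_letter A l) (ck_word A w)"
    by (simp add: ck_word_def)
  ultimately show ?case
    by (simp add: Cons cuntz_krieger_def word_fsa_def mult_const_class[OF ck_gen_norm_le])
qed

text \<open>
  Thus a word can be shown to be allowed by one suitable C*-seminorm, and to be forbidden by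
  computing modulo the kernel of an arbitrary one.
\<close>

lemma forbidden_iff:
  "forbidden A w \<longleftrightarrow> (\<forall>q \<in> null_seminorms (ck_relators A). q (word_fsa w) = 0)"
proof -
  have "forbidden A w \<longleftrightarrow> univ_norm (ck_relators A) (word_fsa w) = 0"
    by (simp add: forbidden_def ck_word_eq cuntz_krieger_def zero_universal_cstar
        const_class_eq_iff[OF ck_gen_norm_le])
  also have "\<dots> \<longleftrightarrow> (\<forall>q \<in> null_seminorms (ck_relators A). q (word_fsa w) = 0)"
  proof
    assume "univ_norm (ck_relators A) (word_fsa w) = 0"
    then show "\<forall>q \<in> null_seminorms (ck_relators A). q (word_fsa w) = 0"
      using univ_norm_upper[OF ck_gen_norm_le, of _ A "word_fsa w"] cstar_nonneg
      by (metis (mono_tags, lifting) antisym mem_Collect_eq)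
  next
    assume "\<forall>q \<in> null_seminorms (ck_relators A). q (word_fsa w) = 0"
    then have "univ_norm (ck_relators A) (word_fsa w) \<le> 0"
      by (intro univ_norm_least[OF ck_gen_norm_le]) auto
    then show "univ_norm (ck_relators A) (word_fsa w) = 0"
      using univ_norm_nonneg[OF ck_gen_norm_le, of A "word_fsa w"] by simp
  qed
  finally show ?thesis .
qed

section \<open>The pre-Hilbert space of finitely supported functions\<close>

text \<open>
  The finitely supported functions form a dense subspace of \<open>\<ell>\<^sup>2\<close>. Operators that map it into
  itself have the same norm on it as on the completion, so no completion is needed.
\<close>

typedef 'x fin_supp = "{v :: 'x \<Rightarrow> complex. finite {x. v x \<noteq> 0}}"
  morphisms coord Abs_fin_supp
  by (rule exI[of _ "\<lambda>_. 0"]) simp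

setup_lifting type_definition_fin_supp

lemma finite_coord: "finite {x. coord v x \<noteq> 0}"
  using coord[of v] by simp

lemma fin_supp_eqI: "(\<And>x. coord v x = coord w x) \<Longrightarrow> v = w"
  by (simp add: coord_inject[symmetric] ext)

instantiation fin_supp :: (type) real_inner
begin

lift_definition zero_fin_supp :: "'a fin_supp" is "\<lambda>_. 0" by simp

lift_definition plus_fin_supp :: "'a fin_supp \<Rightarrow> 'a fin_supp \<Rightarrow> 'a fin_supp"
  is "\<lambda>v w x. v x + w x"
  by (erule (1) rev_finite_subset[OF finite_UnI]) auto

lift_definition uminus_fin_supp :: "'a fin_supp \<Rightarrow> 'a fin_supp" is "\<lambda>v x. - v x" by simp

lift_definition minus_fin_supp :: "'a fin_supp \<Rightarrow> 'a fin_supp \<Rightarrow> 'a fin_supp"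
  is "\<lambda>v w x. v x - w x"
  by (erule (1) rev_finite_subset[OF finite_UnI]) auto

lift_definition scaleR_fin_supp :: "real \<Rightarrow> 'a fin_supp \<Rightarrow> 'a fin_supp"
  is "\<lambda>c v x. c *\<^sub>R v x"
  by (rule finite_subset) auto

lift_definition inner_fin_supp :: "'a fin_supp \<Rightarrow> 'a fin_supp \<Rightarrow> real"
  is "\<lambda>v w. \<Sum>x | v x \<noteq> 0. v x \<bullet> w x" .

definition norm_fin_supp :: "'a fin_supp \<Rightarrow> real" where
  "norm_fin_supp v = sqrt (v \<bullet> v)"

definition dist_fin_supp :: "'a fin_supp \<Rightarrow> 'a fin_supp \<Rightarrow> real" where
  "dist_fin_supp v w = norm (v - w)"

definition sgn_fin_supp :: "'a fin_supp \<Rightarrow> 'a fin_supp" where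
  "sgn_fin_supp v = inverse (norm v) *\<^sub>R v"

definition uniformity_fin_supp :: "('a fin_supp \<times> 'a fin_supp) filter" where
  "uniformity_fin_supp = (INF e\<in>{0<..}. principal {(v, w). dist v w < e})"

definition open_fin_supp :: "'a fin_supp set \<Rightarrow> bool" where
  "open_fin_supp U \<longleftrightarrow> (\<forall>v\<in>U. eventually (\<lambda>(v', w). v' = v \<longrightarrow> w \<in> U) uniformity)"

lemma inner_fin_supp_sum:
  assumes "finite S" "\<And>x. coord v x \<noteq> 0 \<Longrightarrow> coord w x \<noteq> 0 \<Longrightarrow> x \<in> S"
  shows "v \<bullet> w = (\<Sum>x\<in>S. coord v x \<bullet> coord w x)"
proof -
  have "v \<bullet> w = (\<Sum>x | coord v x \<noteq> 0. coord v x \<bullet> coord w x)"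
    by (simp add: inner_fin_supp.rep_eq)
  also have "\<dots> = (\<Sum>x | coord v x \<noteq> 0 \<and> coord w x \<noteq> 0. coord v x \<bullet> coord w x)"
    using finite_coord[of v] by (intro sum.mono_neutral_right) auto
  also have "\<dots> = (\<Sum>x\<in>S. coord v x \<bullet> coord w x)"
    using assms by (intro sum.mono_neutral_left) auto
  finally show ?thesis .
qed

instance
proof
  fix u v w :: "'a fin_supp" and a b :: real and U :: "'a fin_supp set"
  note rep = plus_fin_supp.rep_eq zero_fin_supp.rep_eq uminus_fin_supp.rep_eq
    minus_fin_supp.rep_eq scaleR_fin_supp.rep_eq
  show "u + v + w = u + (v + w)" "u + v = v + u" "0 + u = u" "- u + u = 0" "u - v = u + - v"
    "a *\<^sub>R (u + v) = a *\<^sub>R u + a *\<^sub>R v" "(a + b) *\<^sub>R u = a *\<^sub>R u + b *\<^sub>R u"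
    "a *\<^sub>R b *\<^sub>R u = (a * b) *\<^sub>R u" "1 *\<^sub>R u = u"
    by (rule fin_supp_eqI; simp add: rep algebra_simps)+
  show "dist u v = norm (u - v)" "sgn u = inverse (norm u) *\<^sub>R u" "norm u = sqrt (u \<bullet> u)"
    "(uniformity :: ('a fin_supp \<times> 'a fin_supp) filter) =
      (INF e\<in>{0<..}. principal {(v, w). dist v w < e})"
    "open U \<longleftrightarrow> (\<forall>v\<in>U. eventually (\<lambda>(v', w). v' = v \<longrightarrow> w \<in> U) uniformity)"
    by (simp_all add: dist_fin_supp_def sgn_fin_supp_def norm_fin_supp_def
        uniformity_fin_supp_def open_fin_supp_def)
  define S where "S = {x. coord u x \<noteq> 0} \<union> {x. coord v x \<noteq> 0} \<union> {x. coord w x \<noteq> 0}"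
  have S: "finite S" by (simp add: S_def finite_coord)
  have inner: "u' \<bullet> v' = (\<Sum>x\<in>S. coord u' x \<bullet> coord v' x)"
    if "u' \<in> {u, v, w, u + v, a *\<^sub>R u}" for u' v'
    using that S by (intro inner_fin_supp_sum) (auto simp: S_def rep)
  show "u \<bullet> v = v \<bullet> u"
    by (simp add: inner inner_commute)
  show "(u + v) \<bullet> w = u \<bullet> w + v \<bullet> w"
    by (simp add: inner rep inner_add_left sum.distrib)
  show "(a *\<^sub>R u) \<bullet> v = a * (u \<bullet> v)"
    by (simp add: inner rep sum_distrib_left)
  show "0 \<le> u \<bullet> u"
    by (simp add: inner sum_nonneg)
  show "u \<bullet> u = 0 \<longleftrightarrow> u = 0"
  proof
    assume "u \<bullet> u = 0"
    then have "\<forall>x\<in>S. coord u x \<bullet> coord u x = 0"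
      using S by (simp add: inner sum_nonneg_eq_0_iff)
    then have "coord u x = 0" if "x \<in> S" for x
      using that by (metis inner_eq_zero_iff)
    moreover have "coord u x = 0" if "x \<notin> S" for x
      using that by (simp add: S_def)
    ultimately have "coord u x = 0" for x by blast
    then show "u = 0"
      by (intro fin_supp_eqI) (simp add: rep)
  qed (simp add: inner rep)
qed

end

lemma norm_fin_supp_sq: "(norm v)\<^sup>2 = (\<Sum>x | coord v x \<noteq> 0. (cmod (coord v x))\<^sup>2)"
  by (simp add: power2_norm_eq_inner inner_fin_supp.rep_eq)

section \<open>Representations by partial injections\<close>

text \<open>
  The value \<open>pre l y\<close> is the point that the generator \<open>l\<close> moves to \<open>y\<close>, if there is one. The
  assumption says that the star of \<open>l\<close> moves points back along the inverse partial injection.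
\<close>

locale partial_injections =
  fixes pre :: "'g gen \<Rightarrow> 'x \<Rightarrow> 'x option"
  assumes pre_star: "pre (gen_star l) x = Some y \<longleftrightarrow> pre l y = Some x"
begin

primrec word_pre :: "'g gen list \<Rightarrow> 'x \<Rightarrow> 'x option" where
  "word_pre [] y = Some y"
| "word_pre (l # w) y = Option.bind (pre l y) (word_pre w)"

lemma word_pre_append: "word_pre (u @ w) y = Option.bind (word_pre u y) (word_pre w)"
proof (induction u arbitrary: y)
  case (Cons l u)
  then show ?case by (cases "pre l y") simp_all
qed simp

lemma word_pre_star: "word_pre (rev (map gen_star w)) x = Some y \<longleftrightarrow> word_pre w y = Some x"
  by (induction w arbitrary: x y) (auto simp: word_pre_append bind_eq_Some_conv pre_star)

fun mon_op :: "'g gen_word \<Rightarrow> ('x \<Rightarrow> complex) \<Rightarrow> 'x \<Rightarrow> complex" where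
  "mon_op (Word w) v y = (case word_pre w y of None \<Rightarrow> 0 | Some x \<Rightarrow> v x)"

definition fsa_op :: "'g fsa \<Rightarrow> ('x \<Rightarrow> complex) \<Rightarrow> 'x \<Rightarrow> complex" where
  "fsa_op p v y = (\<Sum>w\<in>Poly_Mapping.keys p. Poly_Mapping.lookup p w * mon_op w v y)"

lemma mon_op_zero [simp]: "mon_op 0 v = v"
  by (simp add: zero_gen_word_def fun_eq_iff)

lemma mon_op_plus: "mon_op (u + w) v = mon_op u (mon_op w v)"
  by (cases u; cases w) (auto simp: fun_eq_iff word_pre_append split: option.split)

lemma mon_op_linear:
  "mon_op w (\<lambda>x. v x + u x) y = mon_op w v y + mon_op w u y"
  "mon_op w (\<lambda>x. c * v x) y = c * mon_op w v y"
  by (cases w; simp split: option.split)+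

lemma fsa_op_add: "fsa_op (p + r) v y = fsa_op p v y + fsa_op r v y"
  unfolding fsa_op_def
  using setsum_keys_plus_distrib[of "\<lambda>w c. c * mon_op w v y" p r] by (simp add: algebra_simps)

lemma fsa_op_single: "fsa_op (Poly_Mapping.single w c) v y = c * mon_op w v y"
  by (simp add: fsa_op_def)

lemma fsa_op_linear:
  "fsa_op p (\<lambda>x. v x + u x) y = fsa_op p v y + fsa_op p u y"
  "fsa_op p (\<lambda>x. c * v x) y = c * fsa_op p v y"
  by (simp_all add: fsa_op_def mon_op_linear sum.distrib sum_distrib_left algebra_simps)

lemma fsa_op_mult: "fsa_op (p * r) v = fsa_op p (fsa_op r v)"
proof (rule ext)
  fix y
  show "fsa_op (p * r) v y = fsa_op p (fsa_op r v) y"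
  proof (induction p rule: fsa_induct)
    case (single u c)
    show ?case
    proof (induction r rule: fsa_induct)
      case (single w d)
      have "fsa_op (Poly_Mapping.single w d) v = (\<lambda>x. d * mon_op w v x)"
        by (simp add: fun_eq_iff fsa_op_single)
      then show ?case by (simp add: mult_single fsa_op_single mon_op_plus mon_op_linear)
    next
      case (add p r)
      have "fsa_op (p + r) v = (\<lambda>x. fsa_op p v x + fsa_op r v x)"
        by (simp add: fun_eq_iff fsa_op_add)
      then show ?case using add by (simp add: fsa_op_add fsa_op_linear algebra_simps)
    qed
  qed (simp add: fsa_op_add algebra_simps)
qed

lemma fsa_op_one: "fsa_op 1 v = v"
  using fsa_op_single[of 0 1 v] by (simp add: fun_eq_iff)

lemma fsa_op_minus: "fsa_op (p - r) v y = fsa_op p v y - fsa_op r v y"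
  using fsa_op_add[of "p - r" r v y] by simp

lemma fsa_op_zero: "fsa_op 0 v y = 0"
  by (simp add: fsa_op_def)

lemma finite_word_pre_supp:
  assumes "finite {x. v x \<noteq> 0}"
  shows "finite {y. \<exists>x. word_pre w y = Some x \<and> v x \<noteq> (0 :: complex)}"
proof (rule finite_subset)
  show "finite ((\<lambda>x. the (word_pre (rev (map gen_star w)) x)) ` {x. v x \<noteq> 0})"
    using assms by simp
  show "{y. \<exists>x. word_pre w y = Some x \<and> v x \<noteq> 0}
      \<subseteq> (\<lambda>x. the (word_pre (rev (map gen_star w)) x)) ` {x. v x \<noteq> 0}"
  proof
    fix y assume "y \<in> {y. \<exists>x. word_pre w y = Some x \<and> v x \<noteq> 0}"
    then obtain x where "word_pre (rev (map gen_star w)) x = Some y" "v x \<noteq> 0"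
      by (auto simp: word_pre_star)
    then show "y \<in> (\<lambda>x. the (word_pre (rev (map gen_star w)) x)) ` {x. v x \<noteq> 0}" by force
  qed
qed

text \<open>
  Substitution along the partial injection that belongs to a word; it yields both the adjoint
  and the boundedness of the operators.
\<close>

lemma sum_word_pre:
  "(\<Sum>y | \<exists>x. word_pre w y = Some x \<and> v x \<noteq> (0 :: complex). f (the (word_pre w y)) y) =
    (\<Sum>x | \<exists>y. word_pre w y = Some x \<and> v x \<noteq> 0. f x (the (word_pre (rev (map gen_star w)) x)))"
proof (rule sum.reindex_bij_witness[where j = "\<lambda>y. the (word_pre w y)"
      and i = "\<lambda>x. the (word_pre (rev (map gen_star w)) x)"])
  have star: "the (word_pre (rev (map gen_star w)) x) = y" if "word_pre w y = Some x" for x y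
    using word_pre_star[THEN iffD2, OF that] by simp
  fix y assume "y \<in> {y. \<exists>x. word_pre w y = Some x \<and> v x \<noteq> 0}"
  then obtain x where x: "word_pre w y = Some x" "v x \<noteq> 0" by blast
  from x show "the (word_pre w y) \<in> {x. \<exists>y. word_pre w y = Some x \<and> v x \<noteq> 0}"
    by auto
  from x(1) show "the (word_pre (rev (map gen_star w)) (the (word_pre w y))) = y"
    using star[OF x(1)] by simp
  then show "f (the (word_pre w y)) (the (word_pre (rev (map gen_star w)) (the (word_pre w y))))
      = f (the (word_pre w y)) y" by simp
next
  have star: "the (word_pre (rev (map gen_star w)) x) = y" if "word_pre w y = Some x" for x y
    using word_pre_star[THEN iffD2, OF that] by simp
  fix x assume "x \<in> {x. \<exists>y. word_pre w y = Some x \<and> v x \<noteq> 0}"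
  then obtain y where y: "word_pre w y = Some x" "v x \<noteq> 0" by blast
  then show "the (word_pre w (the (word_pre (rev (map gen_star w)) x))) = x"
    and "the (word_pre (rev (map gen_star w)) x) \<in> {y. \<exists>x. word_pre w y = Some x \<and> v x \<noteq> 0}"
    using star[OF y(1)] by simp_all
qed

lemma finite_fsa_op:
  assumes "finite {x. v x \<noteq> 0}"
  shows "finite {y. fsa_op p v y \<noteq> 0}"
proof (induction p rule: fsa_induct)
  case (single w c)
  obtain l where w: "w = Word l" by (cases w)
  show ?case
    by (rule finite_subset[OF _ finite_word_pre_supp[OF assms, of l]])
      (auto simp: fsa_op_single w split: option.splits)
next
  case (add p r)
  show ?case
    by (rule finite_subset[OF _ finite_UnI[OF add]]) (auto simp: fsa_op_add)
qed

lift_definition fin_op :: "'g fsa \<Rightarrow> 'x fin_supp \<Rightarrow> 'x fin_supp" is fsa_op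
  by (rule finite_fsa_op)

lemma fin_op_add: "fin_op (p + r) v = fin_op p v + fin_op r v"
  by (rule fin_supp_eqI) (simp add: fin_op.rep_eq plus_fin_supp.rep_eq fsa_op_add)

lemma fin_op_mult: "fin_op (p * r) v = fin_op p (fin_op r v)"
  by (rule fin_supp_eqI) (simp add: fin_op.rep_eq fsa_op_mult)

lemma fin_op_adjoint: "fin_op p v \<bullet> u = v \<bullet> fin_op (fsa_star p) u"
proof (induction p rule: fsa_induct)
  case (single w c)
  obtain l where w: "w = Word l" by (cases w)
  let ?Y = "{y. \<exists>x. word_pre l y = Some x \<and> coord v x \<noteq> 0}"
  let ?X = "{x. \<exists>y. word_pre l y = Some x \<and> coord v x \<noteq> 0}"
  let ?l = "rev (map gen_star l)"
  have move: "(c * a) \<bullet> b = a \<bullet> (cnj c * b)" for a b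
    by (simp add: inner_complex_def algebra_simps)
  have "fin_op (Poly_Mapping.single w c) v \<bullet> u
      = (\<Sum>y\<in>?Y. coord (fin_op (Poly_Mapping.single w c) v) y \<bullet> coord u y)"
    using finite_word_pre_supp[OF finite_coord]
    by (intro inner_fin_supp_sum) (auto simp: fin_op.rep_eq fsa_op_single w split: option.splits)
  also have "\<dots> = (\<Sum>y\<in>?Y. coord v (the (word_pre l y)) \<bullet> (cnj c * coord u y))"
    by (intro sum.cong) (auto simp: fin_op.rep_eq fsa_op_single w move)
  also have "\<dots> = (\<Sum>x\<in>?X. coord v x \<bullet> (cnj c * coord u (the (word_pre ?l x))))"
    by (rule sum_word_pre)
  also have "\<dots> = (\<Sum>x\<in>?X. coord v x \<bullet> coord (fin_op (fsa_star (Poly_Mapping.single w c)) u) x)"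
  proof (rule sum.cong)
    fix x assume "x \<in> ?X"
    then obtain y where "word_pre ?l x = Some y" using word_pre_star by blast
    then show "coord v x \<bullet> (cnj c * coord u (the (word_pre ?l x)))
        = coord v x \<bullet> coord (fin_op (fsa_star (Poly_Mapping.single w c)) u) x"
      by (simp add: fin_op.rep_eq fsa_star_single fsa_op_single w)
  qed simp
  also have "\<dots> = v \<bullet> fin_op (fsa_star (Poly_Mapping.single w c)) u"
    by (intro inner_fin_supp_sum[symmetric] finite_subset[OF _ finite_coord[of v]])
      (auto simp: fin_op.rep_eq fsa_star_single fsa_op_single w word_pre_star
        split: option.splits)
  finally show ?case .
qed (simp add: fin_op_add fsa_star_add inner_add_left inner_add_right)

lemma fin_op_bound: "\<exists>K. \<forall>v. norm (fin_op p v) \<le> norm v * K"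
proof (induction p rule: fsa_induct)
  case (single w c)
  obtain l where w: "w = Word l" by (cases w)
  have "norm (fin_op (Poly_Mapping.single w c) v) \<le> norm v * cmod c" for v
  proof (rule power2_le_imp_le)
    let ?Y = "{y. \<exists>x. word_pre l y = Some x \<and> coord v x \<noteq> 0}"
    let ?X = "{x. \<exists>y. word_pre l y = Some x \<and> coord v x \<noteq> 0}"
    have "{y. coord (fin_op (Poly_Mapping.single w c) v) y \<noteq> 0} \<subseteq> ?Y"
      by (auto simp: fin_op.rep_eq fsa_op_single w split: option.splits)
    then have "(norm (fin_op (Poly_Mapping.single w c) v))\<^sup>2
        \<le> (\<Sum>y\<in>?Y. (cmod (coord (fin_op (Poly_Mapping.single w c) v) y))\<^sup>2)"
      unfolding norm_fin_supp_sq
      by (intro sum_mono2 finite_word_pre_supp[OF finite_coord]) auto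
    also have "\<dots> = (\<Sum>y\<in>?Y. (cmod (c * coord v (the (word_pre l y))))\<^sup>2)"
      by (intro sum.cong) (auto simp: fin_op.rep_eq fsa_op_single w)
    also have "\<dots> = (\<Sum>x\<in>?X. (cmod (c * coord v x))\<^sup>2)"
      by (rule sum_word_pre)
    also have "\<dots> \<le> (\<Sum>x | coord v x \<noteq> 0. (cmod (c * coord v x))\<^sup>2)"
      by (intro sum_mono2 finite_coord) auto
    also have "\<dots> = (norm v * cmod c)\<^sup>2"
      by (simp add: norm_fin_supp_sq norm_mult power_mult_distrib sum_distrib_left mult.commute)
    finally show "(norm (fin_op (Poly_Mapping.single w c) v))\<^sup>2 \<le> (norm v * cmod c)\<^sup>2" .
  qed simp
  then show ?case by blast
next
  case (add p r)
  from add(1) obtain K where "norm (fin_op p v) \<le> norm v * K" for v by blast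
  moreover from add(2) obtain L where "norm (fin_op r v) \<le> norm v * L" for v by blast
  ultimately have "norm (fin_op (p + r) v) \<le> norm v * (K + L)" for v
    unfolding fin_op_add distrib_left by (rule order_trans[OF norm_triangle_ineq add_mono])
  then show ?case by blast
qed

lemma bounded_linear_fin_op: "bounded_linear (fin_op p)"
proof -
  obtain K where K: "norm (fin_op p v) \<le> norm v * K" for v
    using fin_op_bound by blast
  have "coord (a *\<^sub>R v) = (\<lambda>x. complex_of_real a * coord v x)" for a and v :: "'x fin_supp"
    by (simp add: fun_eq_iff scaleR_fin_supp.rep_eq scaleR_conv_of_real)
  moreover have "coord (v + u) = (\<lambda>x. coord v x + coord u x)" for v u :: "'x fin_supp"
    by (simp add: fun_eq_iff plus_fin_supp.rep_eq)
  ultimately show ?thesis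
    by (intro bounded_linear_intro[OF _ _ K] fin_supp_eqI)
      (simp_all add: fin_op.rep_eq plus_fin_supp.rep_eq fsa_op_linear scaleR_fin_supp.rep_eq
        scaleR_conv_of_real)
qed

definition op_norm :: "'g fsa \<Rightarrow> real" where
  "op_norm p = onorm (fin_op p)"

lemma op_norm_bound: "norm (fin_op p v) \<le> op_norm p * norm v"
  unfolding op_norm_def by (rule onorm[OF bounded_linear_fin_op])

lemma op_norm_nonneg: "0 \<le> op_norm p"
  unfolding op_norm_def by (rule onorm_pos_le[OF bounded_linear_fin_op])

lemma op_norm_least:
  assumes "0 \<le> b" "\<And>v. norm (fin_op p v) \<le> b * norm v"
  shows "op_norm p \<le> b"
  unfolding op_norm_def using assms by (rule onorm_bound)

lemma norm_fin_op_scale: "norm (fin_op (fsa_scale c p) v) = cmod c * norm (fin_op p v)"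
proof -
  have coord: "coord (fin_op (fsa_scale c p) v) x = c * coord (fin_op p v) x" for c x
    by (simp add: fsa_scale_def fin_op_mult fin_op.rep_eq fsa_op_single)
  have "(norm (fin_op (fsa_scale c p) v))\<^sup>2 = (cmod c * norm (fin_op p v))\<^sup>2"
    by (cases "c = 0") (simp_all add: norm_fin_supp_sq coord norm_mult power_mult_distrib sum_distrib_left)
  then show ?thesis by (simp add: power2_eq_iff_nonneg)
qed

text \<open>
  The C*-identity rests on \<open>\<parallel>T v\<parallel>\<^sup>2 = \<langle>v, T\<^sup>* T v\<rangle> \<le> \<parallel>T\<^sup>* T\<parallel> \<parallel>v\<parallel>\<^sup>2\<close>, where the adjoint is again an
  operator of the representation.
\<close>

lemma cstar_seminorm_op_norm: "cstar_seminorm op_norm"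
proof -
  have "op_norm (p + r) \<le> op_norm p + op_norm r" for p r
  proof (rule op_norm_least)
    show "norm (fin_op (p + r) v) \<le> (op_norm p + op_norm r) * norm v" for v
      using norm_triangle_ineq[of "fin_op p v" "fin_op r v"] op_norm_bound[of p v]
        op_norm_bound[of r v] by (simp add: fin_op_add algebra_simps)
  qed (simp add: op_norm_nonneg)
  moreover have "op_norm (fsa_scale c p) = cmod c * op_norm p" for c p
  proof (rule antisym)
    have le: "op_norm (fsa_scale c p) \<le> cmod c * op_norm p" for c p
      using op_norm_bound
      by (intro op_norm_least) (auto simp: op_norm_nonneg norm_fin_op_scale mult.assoc
          intro!: mult_left_mono)
    then show "op_norm (fsa_scale c p) \<le> cmod c * op_norm p" .
    show "cmod c * op_norm p \<le> op_norm (fsa_scale c p)"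
    proof (cases "c = 0")
      case False
      then have "op_norm p \<le> cmod (inverse c) * op_norm (fsa_scale c p)"
        using le[of "inverse c" "fsa_scale c p"] by (simp add: fsa_scale_scale fsa_scale_one)
      then show ?thesis using False by (simp add: norm_divide norm_inverse field_simps)
    qed (simp add: op_norm_nonneg)
  qed
  moreover have mult: "op_norm (p * r) \<le> op_norm p * op_norm r" for p r
  proof (rule op_norm_least)
    show "norm (fin_op (p * r) v) \<le> op_norm p * op_norm r * norm v" for v
      using op_norm_bound[of p "fin_op r v"] mult_left_mono[OF op_norm_bound[of r v] op_norm_nonneg[of p]]
      by (simp add: fin_op_mult mult.assoc)
  qed (simp add: op_norm_nonneg)
  moreover have "op_norm (fsa_star p * p) = (op_norm p)\<^sup>2" for p
  proof -
    have sq: "(op_norm r)\<^sup>2 \<le> op_norm (fsa_star r * r)" for r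
    proof -
      have "op_norm r \<le> sqrt (op_norm (fsa_star r * r))"
      proof (rule op_norm_least)
        fix v
        have "(norm (fin_op r v))\<^sup>2 = v \<bullet> fin_op (fsa_star r * r) v"
          by (simp add: power2_norm_eq_inner fin_op_adjoint fin_op_mult)
        also have "\<dots> \<le> norm v * norm (fin_op (fsa_star r * r) v)"
          by (rule norm_cauchy_schwarz)
        also have "\<dots> \<le> norm v * (op_norm (fsa_star r * r) * norm v)"
          by (intro mult_left_mono op_norm_bound) simp
        also have "\<dots> = (sqrt (op_norm (fsa_star r * r)) * norm v)\<^sup>2"
          by (simp add: power_mult_distrib op_norm_nonneg power2_eq_square)
        finally show "norm (fin_op r v) \<le> sqrt (op_norm (fsa_star r * r)) * norm v"
          by (rule power2_le_imp_le) (simp add: op_norm_nonneg)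
      qed (simp add: op_norm_nonneg)
      then show ?thesis
        using op_norm_nonneg by (metis power_mono real_sqrt_pow2)
    qed
    have star_ge: "op_norm r \<le> op_norm (fsa_star r)" for r
    proof (cases "op_norm r = 0")
      case False
      have "op_norm r * op_norm r \<le> op_norm (fsa_star r) * op_norm r"
        using sq[of r] mult[of "fsa_star r" r] by (simp add: power2_eq_square)
      then show ?thesis using False op_norm_nonneg[of r] by simp
    qed (simp add: op_norm_nonneg)
    have "op_norm (fsa_star p) = op_norm p"
      using star_ge[of p] star_ge[of "fsa_star p"] by simp
    then have "op_norm (fsa_star p * p) \<le> (op_norm p)\<^sup>2"
      using mult[of "fsa_star p" p] by (simp add: power2_eq_square)
    then show ?thesis using sq[of p] by simp
  qed
  ultimately show ?thesis by (simp add: cstar_seminorm_def op_norm_nonneg)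
qed

lemma op_norm_eq_0:
  assumes "\<And>v y. fsa_op p v y = 0"
  shows "op_norm p = 0"
proof -
  have "fin_op p v = 0" for v
    by (rule fin_supp_eqI) (simp add: fin_op.rep_eq zero_fin_supp.rep_eq assms)
  then have "op_norm p \<le> 0" by (intro op_norm_least) simp_all
  then show ?thesis using op_norm_nonneg[of p] by simp
qed

lemma op_norm_word_neq_0:
  assumes "word_pre w y = Some x"
  shows "op_norm (Poly_Mapping.single (Word w) 1) \<noteq> 0"
proof
  assume "op_norm (Poly_Mapping.single (Word w) 1) = 0"
  then have zero: "fin_op (Poly_Mapping.single (Word w) 1) v = 0" for v
    using op_norm_bound[of "Poly_Mapping.single (Word w) 1" v] by simp
  define d where "d = Abs_fin_supp (\<lambda>z. if z = x then 1 else 0)"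
  have "coord d = (\<lambda>z. if z = x then 1 else 0)"
    unfolding d_def by (rule Abs_fin_supp_inverse) simp
  then have "coord (fin_op (Poly_Mapping.single (Word w) 1) d) y = 1"
    using assms by (simp add: fin_op.rep_eq fsa_op_single)
  then show False using zero[of d] by (simp add: zero_fin_supp.rep_eq)
qed

end

section \<open>The Fibonacci matrix acting on the natural numbers\<close>

lemma neq_1_iff: "i \<noteq> 1 \<longleftrightarrow> i = (2 :: 2)"
  using exhaust_2[of i] by auto

text \<open>
  The representation \<open>t\<^sub>1 e\<^sub>x = e\<^bsub>2x\<^esub>\<close>, \<open>t\<^sub>2 e\<^bsub>2x\<^esub> = e\<^bsub>2x+1\<^esub>\<close>, \<open>t\<^sub>2 e\<^bsub>2x+1\<^esub> = 0\<close>. It is the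
  representation by shifts of infinite paths in the graph, restricted to the paths that are
  eventually constant with value 1: an even number \<open>x\<close> codes the path that begins with 1
  and goes on with the path of \<open>x div 2\<close>, an odd number \<open>x\<close> the path that begins with 2 and goes
  on with the path of \<open>x - 1\<close>.
\<close>

fun g2_pre :: "2 gen \<Rightarrow> nat \<Rightarrow> nat option" where
  "g2_pre (Gen i) y =
    (if i = 1 then if even y then Some (y div 2) else None
     else if odd y then Some (y - 1) else None)"
| "g2_pre (Adj i) x =
    (if i = 1 then Some (2 * x) else if even x then Some (x + 1) else None)"

interpretation g2: partial_injections g2_pre
proof
  show "g2_pre (gen_star l) x = Some y \<longleftrightarrow> g2_pre l y = Some x" for l x y
    by (cases l) (auto elim!: evenE oddE, presburger+)
qed

fun letter_gen :: "'n letter \<Rightarrow> 'n gen" where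
  "letter_gen (Alpha i) = Adj i"
| "letter_gen (Beta i) = Gen i"

text \<open>
  That \<open>act w y = Some x\<close> means that the operator of \<open>w\<close> maps \<open>e\<^sub>x\<close> to \<open>e\<^sub>y\<close>. For a word of letters
  \<open>\<beta>\<close> with list of indices \<open>m\<close>, the path of \<open>y\<close> is then \<open>m\<close> followed by the path of \<open>x\<close>.
\<close>

abbreviation act :: "2 letter list \<Rightarrow> nat \<Rightarrow> nat option" where
  "act w \<equiv> g2.word_pre (map letter_gen w)"

lemma word_fsa_eq: "word_fsa w = Poly_Mapping.single (Word (map letter_gen w)) 1"
proof (induction w)
  case Nil
  show ?case by (simp add: word_fsa_def flip: zero_gen_word_def)
next
  case (Cons l w)
  have "letter_fsa l = Poly_Mapping.single (Word [letter_gen l]) 1"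
    by (cases l) (simp_all add: fsa_gen_def fsa_star_single)
  then show ?case using Cons by (simp add: word_fsa_def mult_single)
qed

lemma A_G2_simps [simp]: "A_G2 $ 1 $ 1 = 1" "A_G2 $ 1 $ 2 = 1" "A_G2 $ 2 $ 1 = 1" "A_G2 $ 2 $ 2 = 0"
  by (simp_all add: A_G2_def)

lemma op_norm_in_null_seminorms: "g2.op_norm \<in> null_seminorms (ck_relators A_G2)"
proof -
  have ops: "g2.fsa_op (fsa_gen i) v y = (case g2_pre (Gen i) y of None \<Rightarrow> 0 | Some x \<Rightarrow> v x)"
    "g2.fsa_op (fsa_star (fsa_gen i)) v y = (case g2_pre (Adj i) y of None \<Rightarrow> 0 | Some x \<Rightarrow> v x)"
    for i v y
    by (auto simp: fsa_gen_def fsa_star_single g2.fsa_op_single split: option.split)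
  note [simp] = g2.fsa_op_add g2.fsa_op_mult g2.fsa_op_minus g2.fsa_op_one g2.fsa_op_zero ops
  have "g2.op_norm r = 0" if r: "r \<in> ck_relators A_G2" for r
  proof (rule g2.op_norm_eq_0)
    fix v y
    consider (iso) i where "r = fsa_gen i * fsa_star (fsa_gen i) * fsa_gen i - fsa_gen i"
      | (unit) "r = (\<Sum>j\<in>UNIV. fsa_gen j * fsa_star (fsa_gen j)) - 1"
      | (range) i where "r = fsa_star (fsa_gen i) * fsa_gen i
          - (\<Sum>j\<in>UNIV. of_nat (A_G2 $ i $ j) * (fsa_gen j * fsa_star (fsa_gen j)))"
      using r unfolding ck_relators_def by blast
    then show "g2.fsa_op r v y = 0"
    proof cases
      case (iso i)
      then show ?thesis by simp
    next
      case unit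
      then show ?thesis by (simp add: sum_2)
    next
      case (range i)
      then show ?thesis using exhaust_2[of i] by (auto simp: sum_2)
    qed
  qed
  then show ?thesis using g2.cstar_seminorm_op_norm by blast
qed

lemma act_imp_not_forbidden:
  assumes "act w y = Some x"
  shows "\<not> forbidden A_G2 w"
  using op_norm_in_null_seminorms g2.op_norm_word_neq_0[OF assms]
  by (auto simp: forbidden_iff word_fsa_eq)

lemma act_Alpha_iff: "act (map Alpha n) x = Some y \<longleftrightarrow> act (map Beta (rev n)) y = Some x"
  using g2.word_pre_star[of "map letter_gen (map Beta (rev n))" x y]
  by (simp add: rev_map o_def)

abbreviation adm :: "2 list \<Rightarrow> bool" where
  "adm \<equiv> successively (\<lambda>i j. i = 1 \<or> j = 1)"

lemma adm_rev: "adm (rev m) \<longleftrightarrow> adm m"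
  by (simp add: successively_rev disj_commute)

text \<open>
  The odd numbers code the paths that begin with 2, and these cannot be continued to the left
  by another 2.
\<close>

lemma act_Beta_exists:
  assumes "adm m" "odd x \<longrightarrow> m = [] \<or> last m = 1"
  shows "\<exists>y. act (map Beta m) y = Some x \<and> (m \<noteq> [] \<longrightarrow> (odd y \<longleftrightarrow> hd m \<noteq> 1))"
  using assms
proof (induction m)
  case (Cons i m)
  then obtain y where y: "act (map Beta m) y = Some x" "m \<noteq> [] \<longrightarrow> (odd y \<longleftrightarrow> hd m \<noteq> 1)"
    by (auto simp: successively_Cons split: if_splits)
  show ?case
  proof (cases "i = 1")
    case True
    then show ?thesis using y(1) by (intro exI[of _ "2 * y"]) simp
  next
    case False
    then have "even y" using y Cons.prems by (cases "m = []") (auto simp: successively_Cons)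
    then show ?thesis using y(1) False by (intro exI[of _ "Suc y"]) simp
  qed
qed simp

lemma act_Beta_parity:
  assumes "act (map Beta m) y = Some x" "m \<noteq> []"
  shows "odd y \<longleftrightarrow> hd m \<noteq> 1"
  using assms by (cases m) (auto split: if_splits)

lemma act_Beta_adm:
  assumes "act (map Beta m) y = Some x"
  shows "adm m"
  using assms
proof (induction m arbitrary: y)
  case (Cons i m)
  then obtain z where z: "g2_pre (Gen i) y = Some z" "act (map Beta m) z = Some x"
    by (auto simp: bind_eq_Some_conv)
  have "i = 1 \<or> even z" using z(1) by (auto split: if_splits)
  then show ?case
    using Cons.IH[OF z(2)] act_Beta_parity[OF z(2)] by (auto simp: successively_Cons)
qed simp

text \<open>
  Both lists are initial segments of the path of \<open>y\<close>.
\<close>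

lemma act_Beta_prefix:
  assumes "act (map Beta m) y = Some x" "act (map Beta n) y = Some z"
  shows "\<exists>k. (m = n @ k \<and> act (map Beta k) z = Some x) \<or> (n = m @ k \<and> act (map Beta k) x = Some z)"
  using assms
proof (induction m arbitrary: n y)
  case Nil
  then show ?case by auto
next
  case (Cons i m)
  show ?case
  proof (cases n)
    case Nil
    then show ?thesis
      using Cons.prems by (intro exI[of _ "i # m"]) (simp del: g2_pre.simps)
  next
    case (Cons j n')
    obtain y1 y2 where y: "g2_pre (Gen i) y = Some y1" "act (map Beta m) y1 = Some x"
        "g2_pre (Gen j) y = Some y2" "act (map Beta n') y2 = Some z"
      using Cons.prems local.Cons by (auto simp: bind_eq_Some_conv)
    then have "i = j" "y1 = y2" by (auto simp: neq_1_iff split: if_splits)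
    then show ?thesis using Cons.IH[of y1 n'] y local.Cons by auto
  qed
qed

section \<open>Normal forms of words\<close>

type_synonym normal_form = "2 list \<times> bool \<times> 2 list"

text \<open>
  The triple \<open>(m, p, n)\<close> stands for \<open>\<beta>\<^sub>m e \<alpha>\<^sub>n\<close>, where \<open>e\<close> is \<open>t\<^sub>1 t\<^sub>1\<^sup>*\<close> if \<open>p\<close> holds and \<open>1\<close>
  otherwise; different triples may stand for the same operator. A letter is multiplied from the
  left. Cancelling \<open>\<alpha>\<^sub>2\<close> against \<open>\<beta>\<^sub>2\<close> leaves \<open>t\<^sub>2\<^sup>* t\<^sub>2 = t\<^sub>1 t\<^sub>1\<^sup>*\<close>, which is absorbed by a following
  \<open>\<beta>\<^sub>1\<close> and otherwise joins \<open>e\<close>. In the last equation \<open>\<alpha>\<^sub>i\<close> meets \<open>e\<close>, and \<open>t\<^sub>1\<^sup>* t\<^sub>1 t\<^sub>1\<^sup>* = t\<^sub>1\<^sup>*\<close> while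
  \<open>t\<^sub>2\<^sup>* t\<^sub>1 t\<^sub>1\<^sup>* = 0\<close>.
\<close>

fun nf_cons :: "2 letter \<Rightarrow> normal_form \<Rightarrow> normal_form option" where
  "nf_cons (Beta i) (m, p, n) = (if adm (i # m) then Some (i # m, p, n) else None)"
| "nf_cons (Alpha i) (j # m, p, n) = (if i = j then Some (m, p \<or> i = 2 \<and> m = [], n) else None)"
| "nf_cons (Alpha i) ([], p, n) =
    (if adm (i # n) \<and> (p \<longrightarrow> i = 1) then Some ([], False, i # n) else None)"

primrec nf :: "2 letter list \<Rightarrow> normal_form option" where
  "nf [] = Some ([], False, [])"
| "nf (l # w) = Option.bind (nf w) (nf_cons l)"

lemma nf_adm:
  assumes "nf w = Some (m, p, n)"
  shows "adm m \<and> adm n"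
  using assms
proof (induction w arbitrary: m p n)
  case (Cons l w)
  then obtain m' p' n' where "nf w = Some (m', p', n')" "nf_cons l (m', p', n') = Some (m, p, n)"
    by (auto simp: bind_eq_Some_conv)
  then show ?case
    using Cons.IH by (cases "(l, (m', p', n'))" rule: nf_cons.cases)
      (auto simp: successively_Cons split: if_splits)
qed simp

text \<open>
  The projection \<open>t\<^sub>1 t\<^sub>1\<^sup>*\<close> in the middle restricts to the even numbers.
\<close>

lemma act_nf:
  assumes "nf w = Some (m, p, n)"
  shows "act w y = Some x \<longleftrightarrow>
    (\<exists>z. act (map Beta m) y = Some z \<and> (p \<longrightarrow> even z) \<and> act (map Alpha n) z = Some x)"
  using assms
proof (induction w arbitrary: m p n y)
  case Nil
  then show ?case by simp
next
  case (Cons l w)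
  obtain m' p' n' where nf: "nf w = Some (m', p', n')" "nf_cons l (m', p', n') = Some (m, p, n)"
    using Cons.prems by (auto simp: bind_eq_Some_conv)
  have act: "act (l # w) y = Some x \<longleftrightarrow> (\<exists>y'. g2_pre (letter_gen l) y = Some y' \<and>
      (\<exists>z. act (map Beta m') y' = Some z \<and> (p' \<longrightarrow> even z) \<and> act (map Alpha n') z = Some x))"
    by (simp add: bind_eq_Some_conv Cons.IH[OF nf(1)])
  show ?case
  proof (cases l)
    case (Beta i)
    then show ?thesis
      unfolding act using nf(2) by (auto simp: bind_eq_Some_conv split: if_splits)
  next
    case (Alpha i)
    show ?thesis
    proof (cases m')
      case Nil
      then show ?thesis
        unfolding act using nf(2) Alpha by (auto simp: bind_eq_Some_conv split: if_splits)
    next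
      case (Cons j m'')
      have "m = []" if "i = 2" "hd m = 2"
        using that nf_adm[OF nf(1)] nf(2) Alpha Cons by (auto simp: successively_Cons split: if_splits)
      moreover have parity: "even y \<longleftrightarrow> hd m = 1" if "act (map Beta m) y = Some z" "m \<noteq> []" for z
        using act_Beta_parity that by blast
      ultimately show ?thesis
        unfolding act using nf(2) Alpha Cons
        by (cases "m = []"; cases "i = 1")
          (auto simp: bind_eq_Some_conv neq_1_iff split: if_splits)
    qed
  qed
qed

lemma nf_imp_act:
  assumes "nf w = Some (m, p, n)"
  shows "\<exists>y x. act w y = Some x"
proof -
  have "adm m" "adm (rev n)" using nf_adm[OF assms] adm_rev by blast+
  then obtain y x where "act (map Beta m) y = Some 0" "act (map Beta (rev n)) x = Some 0"
    using act_Beta_exists[of _ 0] by (metis even_zero)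
  then show ?thesis unfolding act_nf[OF assms] act_Alpha_iff by auto
qed

section \<open>Normal forms in the Cuntz-Krieger algebra\<close>

context
  fixes q :: "2 fsa \<Rightarrow> real"
  assumes q: "q \<in> null_seminorms (ck_relators A_G2)"
begin

lemma cstar_q: "cstar_seminorm q"
  using q by simp

text \<open>
  Equality in the quotient by the ideal of elements that \<open>q\<close> kills.
\<close>

definition eqv :: "2 fsa \<Rightarrow> 2 fsa \<Rightarrow> bool" (infix "\<doteq>" 50) where
  "p \<doteq> r \<longleftrightarrow> q (p - r) = 0"

lemma eqv_refl: "p \<doteq> p"
  by (simp add: eqv_def cstar_zero[OF cstar_q])

lemma eqv_sym: "p \<doteq> r \<Longrightarrow> r \<doteq> p"
  by (simp add: eqv_def cstar_minus_commute[OF cstar_q])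

lemma eqv_trans [trans]: "p \<doteq> r \<Longrightarrow> r \<doteq> s \<Longrightarrow> p \<doteq> s"
  using cstar_null_add[OF cstar_q, of "p - r" "r - s"] by (simp add: eqv_def)

lemma eqv_mult:
  assumes "p \<doteq> r" "p' \<doteq> r'"
  shows "p * p' \<doteq> r * r'"
proof -
  have "p * p' - r * r' = (p - r) * p' + r * (p' - r')"
    by (simp add: algebra_simps)
  then show ?thesis
    using assms cstar_null_add[OF cstar_q] cstar_null_mult[OF cstar_q] by (metis eqv_def)
qed

lemma eqv_context: "p \<doteq> r \<Longrightarrow> u * p * v \<doteq> u * r * v"
  by (intro eqv_mult eqv_refl)

abbreviation t1 :: "2 fsa" where "t1 \<equiv> fsa_gen 1"
abbreviation t2 :: "2 fsa" where "t2 \<equiv> fsa_gen 2"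
abbreviation s1 :: "2 fsa" where "s1 \<equiv> fsa_star t1"
abbreviation s2 :: "2 fsa" where "s2 \<equiv> fsa_star t2"

lemma relator_unit: "t1 * s1 + t2 * s2 \<doteq> 1"
  and relator_iso: "fsa_gen i * fsa_star (fsa_gen i) * fsa_gen i \<doteq> fsa_gen i"
  and relator_range: "fsa_star (fsa_gen i) * fsa_gen i
    \<doteq> (\<Sum>j\<in>UNIV. of_nat (A_G2 $ i $ j) * (fsa_gen j * fsa_star (fsa_gen j)))"
  using q by (auto simp: ck_relators_def eqv_def sum_2)

lemma eqv_s1_t1: "s1 * t1 \<doteq> 1"
  using eqv_trans[OF relator_range[of 1]] relator_unit by (simp add: sum_2)

lemma eqv_s2_t2: "s2 * t2 \<doteq> t1 * s1"
  using relator_range[of 2] by (simp add: sum_2)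

text \<open>
  Expanding \<open>t\<^sub>i\<^sup>* t\<^sub>i = t\<^sub>i\<^sup>* (t\<^sub>1 t\<^sub>1\<^sup>* + t\<^sub>2 t\<^sub>2\<^sup>*) t\<^sub>i\<close> leaves \<open>(t\<^sub>j\<^sup>* t\<^sub>i)\<^sup>* (t\<^sub>j\<^sup>* t\<^sub>i) = 0\<close> for \<open>j \<noteq> i\<close>, and the
  C*-identity removes the square.
\<close>

lemma eqv_orthogonal: "s1 * t2 \<doteq> 0" "s2 * t1 \<doteq> 0"
proof -
  have null: "u \<doteq> 0" if "fsa_star u * u \<doteq> 0" for u
    using that by (simp add: eqv_def cstar_identity[OF cstar_q])
  have "s2 * (t1 * s1 + t2 * s2) * t2 \<doteq> s2 * 1 * t2"
    by (rule eqv_context[OF relator_unit])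
  moreover have "s2 * (t2 * s2 * t2) \<doteq> s2 * t2"
    by (rule eqv_mult[OF eqv_refl relator_iso])
  ultimately have "q (s2 * (t1 * s1 + t2 * s2) * t2 - s2 * 1 * t2 + (s2 * t2 - s2 * (t2 * s2 * t2))) = 0"
    using cstar_null_add[OF cstar_q] eqv_sym by (metis eqv_def)
  then have "fsa_star (s1 * t2) * (s1 * t2) \<doteq> 0"
    by (simp add: eqv_def fsa_star_mult algebra_simps)
  then show "s1 * t2 \<doteq> 0" by (rule null)
  have "s1 * (t1 * s1 + t2 * s2) * t1 \<doteq> s1 * 1 * t1"
    by (rule eqv_context[OF relator_unit])
  moreover have "s1 * (t1 * s1 * t1) \<doteq> s1 * t1"
    by (rule eqv_mult[OF eqv_refl relator_iso])
  ultimately have "q (s1 * (t1 * s1 + t2 * s2) * t1 - s1 * 1 * t1 + (s1 * t1 - s1 * (t1 * s1 * t1))) = 0"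
    using cstar_null_add[OF cstar_q] eqv_sym by (metis eqv_def)
  then have "fsa_star (s2 * t1) * (s2 * t1) \<doteq> 0"
    by (simp add: eqv_def fsa_star_mult algebra_simps)
  then show "s2 * t1 \<doteq> 0" by (rule null)
qed

lemma eqv_star: "p \<doteq> r \<Longrightarrow> fsa_star p \<doteq> fsa_star r"
proof -
  have "fsa_star p - fsa_star r = fsa_star (p - r)"
    by (rule poly_mapping_eqI) (simp add: lookup_fsa_star lookup_minus)
  then show "p \<doteq> r \<Longrightarrow> fsa_star p \<doteq> fsa_star r"
    by (simp add: eqv_def cstar_star[OF cstar_q])
qed

lemma fsa_star_zero: "fsa_star 0 = 0"
  by (simp add: fsa_star_def)

text \<open>
  Insert \<open>t\<^sub>2 = t\<^sub>2 t\<^sub>2\<^sup>* t\<^sub>2 = t\<^sub>2 t\<^sub>1 t\<^sub>1\<^sup>*\<close> for the left factor.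
\<close>

lemma eqv_t2_t2: "t2 * t2 \<doteq> 0"
proof -
  have "t2 * t2 \<doteq> (t2 * s2 * t2) * t2"
    by (intro eqv_mult eqv_sym[OF relator_iso] eqv_refl)
  also have "\<dots> = t2 * (s2 * t2) * t2" by (simp add: mult.assoc)
  also have "\<dots> \<doteq> t2 * (t1 * s1) * t2" by (rule eqv_context[OF eqv_s2_t2])
  also have "\<dots> = t2 * t1 * (s1 * t2)" by (simp add: mult.assoc)
  also have "\<dots> \<doteq> t2 * t1 * 0" by (rule eqv_mult[OF eqv_refl eqv_orthogonal(1)])
  finally show ?thesis by simp
qed

lemma eqv_s2_s2: "s2 * s2 \<doteq> 0"
  using eqv_star[OF eqv_t2_t2] by (simp add: fsa_star_mult fsa_star_zero)

lemma eqv_proj_t1: "t1 * s1 * t1 \<doteq> t1" and eqv_s1_proj: "s1 * (t1 * s1) \<doteq> s1"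
  using relator_iso[of 1] eqv_star[OF relator_iso[of 1]] by (simp_all add: fsa_star_mult mult.assoc)

lemma eqv_proj_proj: "t1 * s1 * (t1 * s1) \<doteq> t1 * s1"
  using eqv_mult[OF eqv_proj_t1 eqv_refl, of s1] by (simp add: mult.assoc)

lemma eqv_s2_proj: "s2 * (t1 * s1) \<doteq> 0"
  using eqv_mult[OF eqv_orthogonal(2) eqv_refl, of s1] by (simp add: mult.assoc)

fun nf_fsa :: "normal_form \<Rightarrow> 2 fsa" where
  "nf_fsa (m, p, n) = word_fsa (map Beta m) * ((if p then t1 * s1 else 1) * word_fsa (map Alpha n))"

lemma word_fsa_Cons: "word_fsa (l # w) = letter_fsa l * word_fsa w"
  by (simp add: word_fsa_def)

lemma word_fsa_Nil: "word_fsa [] = 1"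
  by (simp add: word_fsa_def)

lemma eqv_prefix:
  assumes "u \<doteq> v"
  shows "u * p \<doteq> v * p"
  using assms by (intro eqv_mult eqv_refl)

lemma eqv_nf_cons:
  assumes "adm m" "adm n"
  shows "letter_fsa l * nf_fsa (m, p, n)
    \<doteq> (case nf_cons l (m, p, n) of None \<Rightarrow> 0 | Some s \<Rightarrow> nf_fsa s)"
proof (cases l)
  case (Beta i)
  show ?thesis
  proof (cases "adm (i # m)")
    case True
    then show ?thesis using Beta eqv_refl by (simp add: word_fsa_Cons mult.assoc)
  next
    case False
    then obtain m' where "i = 2" "m = 2 # m'"
      using assms by (cases m) (auto simp: neq_1_iff)
    then show ?thesis
      using Beta False eqv_prefix[OF eqv_t2_t2] by (simp add: word_fsa_Cons mult.assoc)
  qed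
next
  case (Alpha i)
  show ?thesis
  proof (cases m)
    case (Cons j m')
    consider "i = 1" "j = 1" | "i = 2" "j = 2" "m' = []" "p" | "i = 2" "j = 2" "m' = []" "\<not> p"
      | m'' where "i = 2" "j = 2" "m' = 1 # m''" | "i = 1" "j = 2" | "i = 2" "j = 1"
      using assms Cons exhaust_2[of i] exhaust_2[of j] by (cases m') auto
    then show ?thesis
    proof cases
      case 1
      then show ?thesis
        using eqv_prefix[OF eqv_s1_t1] Alpha Cons by (simp add: word_fsa_Cons mult.assoc)
    next
      case 2
      then show ?thesis
        using eqv_prefix[OF eqv_trans[OF eqv_prefix[OF eqv_s2_t2] eqv_proj_proj]] Alpha Cons
        by (simp add: word_fsa_Cons word_fsa_Nil mult.assoc)
    next
      case 3
      then show ?thesis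
        using eqv_prefix[OF eqv_s2_t2] Alpha Cons
        by (simp add: word_fsa_Cons word_fsa_Nil mult.assoc)
    next
      case (4 m'')
      then show ?thesis
        using eqv_prefix[OF eqv_trans[OF eqv_prefix[OF eqv_s2_t2] eqv_proj_t1]] Alpha Cons
        by (simp add: word_fsa_Cons word_fsa_Nil mult.assoc)
    next
      case 5
      then show ?thesis
        using eqv_prefix[OF eqv_orthogonal(1)] Alpha Cons by (simp add: word_fsa_Cons mult.assoc)
    next
      case 6
      then show ?thesis
        using eqv_prefix[OF eqv_orthogonal(2)] Alpha Cons by (simp add: word_fsa_Cons mult.assoc)
    qed
  next
    case Nil
    consider "p" "i = 1" | "p" "i = 2" | "\<not> p" "adm (i # n)" | n' where "\<not> p" "i = 2" "n = 2 # n'"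
      using assms exhaust_2[of i] neq_1_iff by (cases n) auto
    then show ?thesis
    proof cases
      case 1
      then have "adm (i # n)" using assms by (simp add: successively_Cons)
      then show ?thesis
        using 1 eqv_prefix[OF eqv_s1_proj] Alpha Nil
        by (simp add: word_fsa_Cons word_fsa_Nil mult.assoc)
    next
      case 2
      then show ?thesis
        using eqv_prefix[OF eqv_s2_proj] Alpha Nil
        by (simp add: word_fsa_Cons word_fsa_Nil mult.assoc)
    next
      case 3
      then show ?thesis
        using Alpha Nil eqv_refl by (simp add: word_fsa_Cons word_fsa_Nil)
    next
      case (4 n')
      then show ?thesis
        using eqv_prefix[OF eqv_s2_s2] Alpha Nil
        by (simp add: word_fsa_Cons word_fsa_Nil mult.assoc)
    qed
  qed
qed

lemma eqv_nf: "word_fsa w \<doteq> (case nf w of None \<Rightarrow> 0 | Some s \<Rightarrow> nf_fsa s)"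
proof (induction w)
  case Nil
  show ?case by (simp add: word_fsa_Nil eqv_refl)
next
  case (Cons l w)
  have step: "word_fsa (l # w) \<doteq> letter_fsa l * (case nf w of None \<Rightarrow> 0 | Some s \<Rightarrow> nf_fsa s)"
    unfolding word_fsa_Cons by (rule eqv_mult[OF eqv_refl Cons])
  show ?case
  proof (cases "nf w")
    case None
    then show ?thesis using step by simp
  next
    case (Some s)
    obtain m p n where s: "s = (m, p, n)" by (cases s)
    have "adm m" "adm n" using nf_adm Some s by blast+
    from eqv_nf_cons[OF this, of l p] show ?thesis
      using eqv_trans[OF step] Some s by simp
  qed
qed

lemma nf_None_imp_null: "nf w = None \<Longrightarrow> q (word_fsa w) = 0"
  using eqv_nf[of w] by (simp add: eqv_def)

end

text \<open>
  A word without a normal form vanishes under every C*-seminorm, and a word with a normal form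
  acts non-trivially on \<open>\<nat>\<close>; so this one representation decides.
\<close>

lemma forbidden_G2_iff: "forbidden A_G2 w \<longleftrightarrow> (\<forall>y. act w y = None)"
proof
  assume "forbidden A_G2 w"
  then show "\<forall>y. act w y = None" using act_imp_not_forbidden by (metis option.exhaust)
next
  assume "\<forall>y. act w y = None"
  then have "nf w = None" using nf_imp_act by (metis option.exhaust option.distinct(1) prod.exhaust)
  then show "forbidden A_G2 w" using nf_None_imp_null by (auto simp: forbidden_iff)
qed

section \<open>Words whose powers are all admissible\<close>

lemma act_imp_nf:
  assumes "act w y = Some x"
  obtains s where "nf w = Some s"
  using act_imp_not_forbidden[OF assms] nf_None_imp_null[of _ w]
  by (cases "nf w") (auto simp: forbidden_iff)

text \<open>
  The product \<open>\<alpha>\<^sub>n \<beta>\<^sub>m\<close> inside the square of \<open>\<beta>\<^sub>m e \<alpha>\<^sub>n\<close> cancels exactly if one of \<open>m\<close> and \<open>rev n\<close>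
  is a prefix of the other. The rest \<open>k\<close> of the longer list is repeated in all further powers,
  so it has to follow itself, and if \<open>e\<close> is \<open>t\<^sub>1 t\<^sub>1\<^sup>*\<close> then \<open>k\<close> must not begin with 2.
\<close>

fun recurrent :: "normal_form \<Rightarrow> bool" where
  "recurrent (m, p, n) \<longleftrightarrow>
    (\<exists>k. adm (k @ k) \<and> (p \<longrightarrow> k = [] \<or> hd k = 1) \<and> (m = rev n @ k \<or> rev n = m @ k))"

declare recurrent.simps [simp del]

text \<open>
  Let \<open>w\<close> map \<open>e\<^bsub>x'\<^esub>\<close> to \<open>e\<^sub>x\<close> and \<open>e\<^sub>x\<close> to \<open>e\<^sub>y\<close>. The path of \<open>x\<close> then begins both with \<open>m\<close> and with
  \<open>rev n\<close>. If \<open>m = rev n @ k\<close>, the path of \<open>y\<close> shows that \<open>k\<close> can follow itself; in the other case,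
  the path of \<open>x'\<close> does.
\<close>

lemma recurrent_if_square:
  assumes nf: "nf w = Some s" and act: "act w y = Some x" "act w x = Some x'"
  shows "recurrent s"
proof -
  obtain m p n where s: "s = (m, p, n)" by (cases s)
  note act_iff = act_nf[OF nf[unfolded s], unfolded act_Alpha_iff]
  from act obtain z z' where z: "act (map Beta m) y = Some z" "p \<longrightarrow> even z"
      "act (map Beta (rev n)) x = Some z"
    and z': "act (map Beta m) x = Some z'" "p \<longrightarrow> even z'" "act (map Beta (rev n)) x' = Some z'"
    unfolding act_iff by blast
  have split: "\<exists>u. act (map Beta k) u = Some c" if "act (map Beta (a @ k)) b = Some c" for a k b c
    using that by (auto simp: g2.word_pre_append bind_eq_Some_conv simp del: map_map)
  have adm: "adm (k @ k)" if "act (map Beta k) a = Some b" "act (map Beta k) b = Some c" for k a b c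
    using that by (intro act_Beta_adm[of _ a c]) (simp add: g2.word_pre_append del: map_map)
  obtain k where "(m = rev n @ k \<and> act (map Beta k) z = Some z') \<or>
      (rev n = m @ k \<and> act (map Beta k) z' = Some z)"
    using act_Beta_prefix[OF z'(1) z(3)] by blast
  then show ?thesis
  proof
    assume k: "m = rev n @ k \<and> act (map Beta k) z = Some z'"
    then obtain u where u: "act (map Beta k) u = Some z" using split z(1) by blast
    show ?thesis
      unfolding s recurrent.simps
      using k adm[OF u] z(2) act_Beta_parity[of k z z'] by (intro exI[of _ k]) auto
  next
    assume k: "rev n = m @ k \<and> act (map Beta k) z' = Some z"
    then obtain u where u: "act (map Beta k) u = Some z'" using split[of m k x' z'] z'(3) by auto
    show ?thesis
      unfolding s recurrent.simps
      using k adm[OF u] z'(2) act_Beta_parity[of k z' z] by (intro exI[of _ k]) auto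
  qed
qed

text \<open>
  A fixed point of the powers of \<open>w\<close> would be given by the periodic path \<open>k k k \<dots>\<close>, which is
  coded by no number unless all its entries are 1. The chain replaces it by paths that begin with
  more and more copies of \<open>k\<close>.
\<close>

lemma act_Beta_chain:
  assumes "adm (k @ k)"
  obtains z where "\<And>N. act (map Beta k) (z (Suc N)) = Some (z N)"
    and "\<And>N. odd (z N) \<Longrightarrow> k \<noteq> [] \<and> hd k \<noteq> 1"
proof -
  have "\<exists>z. \<forall>N. (odd (z N) \<longrightarrow> k \<noteq> [] \<and> hd k \<noteq> 1) \<and> act (map Beta k) (z (Suc N)) = Some (z N)"
  proof (rule dependent_nat_choice)
    show "\<exists>x :: nat. odd x \<longrightarrow> k \<noteq> [] \<and> hd k \<noteq> 1" by (rule exI[of _ 0]) simp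
    fix x :: nat assume x: "odd x \<longrightarrow> k \<noteq> [] \<and> hd k \<noteq> 1"
    then have "odd x \<longrightarrow> k = [] \<or> last k = 1" "adm k"
      using assms by (auto simp: successively_append_iff)
    then obtain y where "act (map Beta k) y = Some x" "k \<noteq> [] \<longrightarrow> (odd y \<longleftrightarrow> hd k \<noteq> 1)"
      using act_Beta_exists by blast
    then show "\<exists>y. (odd y \<longrightarrow> k \<noteq> [] \<and> hd k \<noteq> 1) \<and> act (map Beta k) y = Some x"
      using x by (intro exI[of _ y]) auto
  qed
  then show ?thesis using that by blast
qed

text \<open>
  For the shorter list \<open>a\<close> of \<open>m\<close> and \<open>rev n\<close>, prefixing the chain by \<open>a\<close> gives numbers that \<open>w\<close>
  moves along the chain, forwards or backwards according to which list is longer.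
\<close>

lemma act_power_if_recurrent:
  assumes nf: "nf w = Some s" and "recurrent s"
  shows "\<exists>y x. act (concat (replicate N w)) y = Some x"
proof -
  obtain m p n where s: "s = (m, p, n)" by (cases s)
  note act_iff = act_nf[OF nf[unfolded s], unfolded act_Alpha_iff]
  have adm: "adm m" "adm (rev n)" using nf_adm nf s adm_rev by blast+
  obtain k where k: "adm (k @ k)" "p \<longrightarrow> k = [] \<or> hd k = 1" "m = rev n @ k \<or> rev n = m @ k"
    using assms(2) by (auto simp: s recurrent.simps)
  obtain z where z: "\<And>N. act (map Beta k) (z (Suc N)) = Some (z N)"
      "\<And>N. odd (z N) \<Longrightarrow> k \<noteq> [] \<and> hd k \<noteq> 1"
    using act_Beta_chain[OF k(1)] by blast
  have even: "p \<longrightarrow> even (z N)" for N using k(2) z(2) by blast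
  define a where "a = (if m = rev n @ k then rev n else m)"
  have a: "adm (a @ k)"
  proof (cases "m = rev n @ k")
    case False
    then show ?thesis using adm(2) k(3) by (metis a_def)
  qed (use adm(1) in \<open>simp add: a_def\<close>)
  have "\<exists>y. act (map Beta a) y = Some (z N)" for N
    using act_Beta_exists[of a "z N"] a z(2)[of N] by (auto simp: successively_append_iff)
  then obtain y where y: "\<And>N. act (map Beta a) (y N) = Some (z N)" by metis
  have y': "act (map Beta (a @ k)) (y (Suc N)) = Some (z N)" for N
    using y z(1) by (simp add: g2.word_pre_append del: map_map)
  show ?thesis
  proof (cases "m = rev n @ k")
    case True
    then have "act w (y (Suc N)) = Some (y N)" for N
      unfolding act_iff using y[of N] y'[of N] even[of N] by (auto simp: a_def simp del: map_map)
    then have "act (concat (replicate N w)) (y N) = Some (y 0)"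
      by (induction N) (simp_all add: g2.word_pre_append del: map_map)
    then show ?thesis by blast
  next
    case False
    then have "rev n = m @ k" using k(3) by blast
    then have step: "act w (y N) = Some (y (Suc N))" for N
      unfolding act_iff using False y[of N] y'[of N] even[of N] by (auto simp: a_def simp del: map_map)
    have "act (concat (replicate N w)) (y M) = Some (y (M + N))" for M
      using step by (induction N arbitrary: M) (simp_all add: g2.word_pre_append del: map_map)
    then show ?thesis by blast
  qed
qed

section \<open>Periodic points as words\<close>

definition recurrent_words :: "nat \<Rightarrow> 2 letter list set" where
  "recurrent_words N = {w. length w = N \<and> (\<exists>s. nf w = Some s \<and> recurrent s)}"

definition window :: "(int \<Rightarrow> 'a) \<Rightarrow> int \<Rightarrow> nat \<Rightarrow> 'a list" where
  "window x k n = map (\<lambda>j. x (k + int j)) [0..<n]"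

lemma window_add: "window x k (a + b) = window x k a @ window x (k + int a) b"
proof -
  have "[0..<a + b] = [0..<a] @ map (\<lambda>j. a + j) [0..<b]"
    by (simp add: upt_add_eq_append[of 0 a b] map_add_upt add.commute)
  then show ?thesis by (simp add: window_def o_def add.assoc)
qed

lemma left_shift_power: "(left_shift ^^ n) x = (\<lambda>k. x (k + int n))"
  by (induction n) (auto simp: left_shift_def fun_eq_iff algebra_simps)

lemma periodic_iff: "(left_shift ^^ N) x = x \<longleftrightarrow> (\<forall>k. x (k + int N) = x k)"
  by (simp add: left_shift_power fun_eq_iff)

lemma periodic_mult:
  assumes "(left_shift ^^ N) x = x"
  shows "x (k + int N * c) = x k"
proof (induction c rule: int_induct[of _ 0])
  case (step1 i)
  then show ?case
    using assms[unfolded periodic_iff, rule_format, of "k + int N * i"] by (simp add: algebra_simps)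
next
  case (step2 i)
  then show ?case
    using assms[unfolded periodic_iff, rule_format, of "k + int N * (i - 1)"]
    by (simp add: algebra_simps)
qed simp

lemma window_periodic:
  assumes "(left_shift ^^ N) x = x"
  shows "window x (k + int N * c) n = window x k n"
proof -
  have "x (k + int N * c + int j) = x (k + int j)" for j
    using periodic_mult[OF assms, of "k + int j" c] by (simp add: algebra_simps)
  then show ?thesis by (simp add: window_def)
qed

lemma window_power:
  assumes "(left_shift ^^ N) x = x"
  shows "window x 0 (c * N) = concat (replicate c (window x 0 N))"
proof (induction c)
  case 0
  then show ?case by (simp add: window_def)
next
  case (Suc c)
  have "window x (0 + int N * 1) (c * N) = window x 0 (c * N)"
    by (rule window_periodic[OF assms])
  then show ?case using Suc by (simp add: window_add)
qed

lemma mem_shift_iff: "x \<in> markov_dyck_shift A_G2 \<longleftrightarrow> (\<forall>k n. \<exists>y z. act (window x k n) y = Some z)"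
  unfolding markov_dyck_shift_def forbidden_G2_iff window_def[symmetric] by auto

text \<open>
  A point of the shift contains the square of its period word. Conversely, every window of the
  periodic point lies inside a power of this word, and a factor of an allowed word is allowed.
\<close>

lemma periodic_mem_shift_iff:
  assumes "N > 0" and per: "(left_shift ^^ N) x = x"
  shows "x \<in> markov_dyck_shift A_G2 \<longleftrightarrow> window x 0 N \<in> recurrent_words N"
proof
  let ?w = "window x 0 N"
  have len: "length ?w = N" by (simp add: window_def)
  {
    assume "x \<in> markov_dyck_shift A_G2"
    then obtain y z where "act (window x 0 (2 * N)) y = Some z"
      unfolding mem_shift_iff by blast
    moreover have "window x 0 (2 * N) = ?w @ ?w"
      using window_power[OF per, of 2] by (simp add: numeral_2_eq_2)
    ultimately obtain y' where act: "act ?w y = Some y'" "act ?w y' = Some z"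
      by (auto simp: g2.word_pre_append bind_eq_Some_conv simp del: map_map)
    obtain s where "nf ?w = Some s" using act_imp_nf[OF act(1)] .
    then show "?w \<in> recurrent_words N"
      using recurrent_if_square[OF _ act] len unfolding recurrent_words_def by blast
  next
    assume "?w \<in> recurrent_words N"
    then obtain s where s: "nf ?w = Some s" "recurrent s" by (auto simp: recurrent_words_def)
    show "x \<in> markov_dyck_shift A_G2"
      unfolding mem_shift_iff
    proof (intro allI)
      fix k n
      \<comment> \<open>Shifted by a multiple of \<open>N\<close>, the window begins in \<open>[0, N)\<close>, and \<open>r + n\<close> periods cover it.\<close>
      define r where "r = nat (k mod int N)"
      have "window x k n = window x (k mod int N + int N * (k div int N)) n"
        by simp
      also have "\<dots> = window x (k mod int N) n"
        by (rule window_periodic[OF per])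
      also have "\<dots> = window x (int r) n"
        using assms(1) by (simp add: r_def)
      finally have win: "window x k n = window x (int r) n" .
      have "(r + n) * 1 \<le> (r + n) * N" using assms(1) by (intro mult_left_mono) simp_all
      then obtain l where l: "(r + n) * N = r + (n + l)"
        by (metis add.assoc le_Suc_ex mult_1_right)
      obtain y z where "act (concat (replicate (r + n) ?w)) y = Some z"
        using act_power_if_recurrent[OF s] by blast
      moreover have "concat (replicate (r + n) ?w)
          = window x 0 r @ window x (int r) n @ window x (int r + int n) l"
        using window_power[OF per, of "r + n"] by (simp add: l window_add)
      ultimately show "\<exists>y z. act (window x k n) y = Some z"
        by (auto simp: win g2.word_pre_append bind_eq_Some_conv simp del: map_map)
    qed
  }
qed

lemma card_periodic_pts:
  assumes "N > 0"
  shows "card (periodic_pts (markov_dyck_shift A_G2) N) = card (recurrent_words N)"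
proof (rule bij_betw_same_card)
  let ?x = "\<lambda>w k. w ! nat (k mod int N)"
  have per_x: "(left_shift ^^ N) (?x w) = ?x w" for w :: "2 letter list"
    by (simp add: periodic_iff)
  have window_x: "window (?x w) 0 N = w" if "length w = N" for w :: "2 letter list"
    using that by (intro nth_equalityI) (simp_all add: window_def)
  show "bij_betw (\<lambda>x. window x 0 N) (periodic_pts (markov_dyck_shift A_G2) N) (recurrent_words N)"
  proof (rule bij_betw_byWitness[where f' = ?x])
    show "\<forall>x\<in>periodic_pts (markov_dyck_shift A_G2) N. ?x (window x 0 N) = x"
    proof
      fix x assume "x \<in> periodic_pts (markov_dyck_shift A_G2) N"
      then have x: "(left_shift ^^ N) x = x" by (simp add: periodic_pts_def)
      show "?x (window x 0 N) = x"
      proof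
        fix k
        have "x k = x (k mod int N + int N * (k div int N))" by simp
        also have "\<dots> = x (k mod int N)" by (rule periodic_mult[OF x])
        finally show "?x (window x 0 N) k = x k"
          using assms by (simp add: window_def nat_less_iff)
      qed
    qed
    show "\<forall>w\<in>recurrent_words N. window (?x w) 0 N = w"
      using window_x by (auto simp: recurrent_words_def)
    show "(\<lambda>x. window x 0 N) ` periodic_pts (markov_dyck_shift A_G2) N \<subseteq> recurrent_words N"
      using periodic_mem_shift_iff[OF assms] by (auto simp: periodic_pts_def)
    show "?x ` recurrent_words N \<subseteq> periodic_pts (markov_dyck_shift A_G2) N"
    proof
      fix x assume "x \<in> ?x ` recurrent_words N"
      then obtain w where w: "w \<in> recurrent_words N" "x = ?x w" by blast
      then have "window x 0 N \<in> recurrent_words N"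
        using window_x by (auto simp: recurrent_words_def)
      then show "x \<in> periodic_pts (markov_dyck_shift A_G2) N"
        using periodic_mem_shift_iff[OF assms, of x] per_x w(2) by (simp add: periodic_pts_def)
    qed
  qed
qed

section \<open>Locally finite sums of power series\<close>

unbundle no vec_syntax
unbundle fps_syntax

text \<open>
  Infinite sums of power series are formed coefficientwise; each coefficient receives only
  finitely many contributions.
\<close>

definition locally_finite :: "('i \<Rightarrow> real fps) \<Rightarrow> 'i set \<Rightarrow> bool" where
  "locally_finite f I \<longleftrightarrow> (\<forall>n. finite {i \<in> I. f i $ n \<noteq> 0})"

definition family_sum :: "('i \<Rightarrow> real fps) \<Rightarrow> 'i set \<Rightarrow> real fps" where
  "family_sum f I = Abs_fps (\<lambda>n. \<Sum>i | i \<in> I \<and> f i $ n \<noteq> 0. f i $ n)"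

lemma family_sum_nth:
  assumes "finite S" "S \<subseteq> I" "\<And>i. i \<in> I \<Longrightarrow> f i $ n \<noteq> 0 \<Longrightarrow> i \<in> S"
  shows "family_sum f I $ n = (\<Sum>i\<in>S. f i $ n)"
  unfolding family_sum_def fps_nth_Abs_fps using assms by (intro sum.mono_neutral_left) auto

lemma locally_finite_finite: "finite I \<Longrightarrow> locally_finite f I"
  by (simp add: locally_finite_def)

lemma family_sum_finite: "finite I \<Longrightarrow> family_sum f I = (\<Sum>i\<in>I. f i)"
  by (rule fps_ext) (simp add: family_sum_nth[of I] fps_sum_nth)

lemma locally_finite_subset:
  assumes "locally_finite f I" "J \<subseteq> I"
  shows "locally_finite f J"
  unfolding locally_finite_def
proof
  fix n
  show "finite {i \<in> J. f i $ n \<noteq> 0}"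
    by (rule finite_subset[of _ "{i \<in> I. f i $ n \<noteq> 0}"])
      (use assms in \<open>auto simp: locally_finite_def\<close>)
qed

lemma locally_finite_upto:
  assumes "locally_finite f I"
  shows "finite {i \<in> I. \<exists>k\<le>n. f i $ k \<noteq> 0}"
proof -
  have "{i \<in> I. \<exists>k\<le>n. f i $ k \<noteq> 0} = (\<Union>k\<le>n. {i \<in> I. f i $ k \<noteq> 0})" by auto
  then show ?thesis using assms by (simp add: locally_finite_def)
qed

lemma family_sum_Un:
  assumes "locally_finite f I" "locally_finite f J" "I \<inter> J = {}"
  shows "family_sum f (I \<union> J) = family_sum f I + family_sum f J"
proof (rule fps_ext)
  fix n
  let ?S = "\<lambda>K. {i \<in> K. f i $ n \<noteq> 0}"
  have fin: "finite (?S I)" "finite (?S J)" using assms by (simp_all add: locally_finite_def)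
  have "family_sum f (I \<union> J) $ n = (\<Sum>i\<in>?S I \<union> ?S J. f i $ n)"
    using fin by (intro family_sum_nth) auto
  also have "\<dots> = (\<Sum>i\<in>?S I. f i $ n) + (\<Sum>i\<in>?S J. f i $ n)"
    using fin assms(3) by (intro sum.union_disjoint) auto
  finally show "family_sum f (I \<union> J) $ n = (family_sum f I + family_sum f J) $ n"
    by (simp add: family_sum_def)
qed

lemma family_sum_reindex:
  assumes "inj_on g I"
  shows "family_sum f (g ` I) = family_sum (\<lambda>i. f (g i)) I"
proof (rule fps_ext)
  fix n
  have "{j. j \<in> g ` I \<and> f j $ n \<noteq> 0} = g ` {i. i \<in> I \<and> f (g i) $ n \<noteq> 0}" by auto
  moreover have "inj_on g {i. i \<in> I \<and> f (g i) $ n \<noteq> 0}"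
    using assms by (rule inj_on_subset) auto
  ultimately show "family_sum f (g ` I) $ n = family_sum (\<lambda>i. f (g i)) I $ n"
    by (simp add: family_sum_def sum.reindex)
qed

lemma family_sum_cong: "I = J \<Longrightarrow> (\<And>i. i \<in> J \<Longrightarrow> f i = g i) \<Longrightarrow> family_sum f I = family_sum g J"
  unfolding family_sum_def by (intro arg_cong[of _ _ Abs_fps] ext sum.cong) auto

lemma family_sum_Times:
  assumes "locally_finite f I" "locally_finite g J"
  shows "locally_finite (\<lambda>(i, j). f i * g j) (I \<times> J)"
    and "family_sum (\<lambda>(i, j). f i * g j) (I \<times> J) = family_sum f I * family_sum g J"
proof -
  let ?S = "\<lambda>n. {i \<in> I. \<exists>k\<le>n. f i $ k \<noteq> 0}" and ?T = "\<lambda>n. {j \<in> J. \<exists>k\<le>n. g j $ k \<noteq> 0}"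
  have fin: "finite (?S n)" "finite (?T n)" for n
    using assms by (simp_all add: locally_finite_upto)
  have supp: "i \<in> ?S n \<and> j \<in> ?T n" if "i \<in> I" "j \<in> J" "(f i * g j) $ n \<noteq> 0" for i j n
  proof -
    obtain k where "k \<le> n" "f i $ k * g j $ (n - k) \<noteq> 0"
      using \<open>(f i * g j) $ n \<noteq> 0\<close> by (auto simp: fps_mult_nth elim: sum.not_neutral_contains_not_neutral)
    then have "k \<le> n \<and> f i $ k \<noteq> 0" "n - k \<le> n \<and> g j $ (n - k) \<noteq> 0"
      by auto
    then have "\<exists>k\<le>n. f i $ k \<noteq> 0" "\<exists>k\<le>n. g j $ k \<noteq> 0"
      by blast+
    then show ?thesis using that by auto
  qed
  show "locally_finite (\<lambda>(i, j). f i * g j) (I \<times> J)"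
    unfolding locally_finite_def
  proof
    fix n
    show "finite {x \<in> I \<times> J. (case x of (i, j) \<Rightarrow> f i * g j) $ n \<noteq> 0}"
      using supp by (intro finite_subset[OF _ finite_cartesian_product[OF fin[of n]]]) auto
  qed
  show "family_sum (\<lambda>(i, j). f i * g j) (I \<times> J) = family_sum f I * family_sum g J"
  proof (rule fps_ext)
    fix n
    have "family_sum (\<lambda>(i, j). f i * g j) (I \<times> J) $ n
        = (\<Sum>x\<in>?S n \<times> ?T n. (case x of (i, j) \<Rightarrow> f i * g j) $ n)"
      using supp fin by (intro family_sum_nth) auto
    also have "\<dots> = (\<Sum>i\<in>?S n. \<Sum>j\<in>?T n. \<Sum>k=0..n. f i $ k * g j $ (n - k))"
      by (subst sum.cartesian_product) (simp add: fps_mult_nth case_prod_beta)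
    also have "\<dots> = (\<Sum>i\<in>?S n. \<Sum>k=0..n. \<Sum>j\<in>?T n. f i $ k * g j $ (n - k))"
      by (intro sum.cong refl sum.swap)
    also have "\<dots> = (\<Sum>k=0..n. \<Sum>i\<in>?S n. \<Sum>j\<in>?T n. f i $ k * g j $ (n - k))"
      by (rule sum.swap)
    also have "\<dots> = (\<Sum>k=0..n. (\<Sum>i\<in>?S n. f i $ k) * (\<Sum>j\<in>?T n. g j $ (n - k)))"
      by (simp add: sum_product)
    also have "\<dots> = (\<Sum>k=0..n. family_sum f I $ k * family_sum g J $ (n - k))"
    proof (intro sum.cong refl arg_cong2[of _ _ _ _ "(*)"])
      fix k assume "k \<in> {0..n}"
      then show "(\<Sum>i\<in>?S n. f i $ k) = family_sum f I $ k"
        using fin by (intro family_sum_nth[symmetric]) auto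
      have "n - k \<le> n" by simp
      then show "(\<Sum>j\<in>?T n. g j $ (n - k)) = family_sum g J $ (n - k)"
        using fin by (intro family_sum_nth[symmetric]) blast+
    qed
    finally show "family_sum (\<lambda>(i, j). f i * g j) (I \<times> J) $ n = (family_sum f I * family_sum g J) $ n"
      by (simp add: fps_mult_nth)
  qed
qed

section \<open>Weighted sums over admissible words\<close>

definition weight :: "(2 \<Rightarrow> real fps) \<Rightarrow> 2 list \<Rightarrow> real fps" where
  "weight c w = prod_list (map c w)"

lemma weight_simps [simp]:
  "weight c [] = 1" "weight c (i # w) = c i * weight c w" "weight c (u @ w) = weight c u * weight c w"
  by (simp_all add: weight_def)

lemma weight_rev [simp]: "weight c (rev w) = weight c w"
  by (induction w) (simp_all add: mult.commute)

lemma weight_square: "weight (\<lambda>i. (c i)\<^sup>2) w = (weight c w)\<^sup>2"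
  by (induction w) (simp_all add: power_mult_distrib)

text \<open>
  The normal forms to be summed over are built from these sets: lists without adjacent 2s, those
  of them that may follow a 2, and the non-empty lists that may follow themselves, divided by their
  first entry.
\<close>

abbreviation "adm_words \<equiv> {w. adm w}"
abbreviation "adm_words1 \<equiv> {w. adm w \<and> (w = [] \<or> hd w = 1)}"
abbreviation "loops1 \<equiv> {k. k \<noteq> [] \<and> hd k = 1 \<and> adm (k @ k)}"
abbreviation "loops2 \<equiv> {k. k \<noteq> [] \<and> hd k \<noteq> 1 \<and> adm (k @ k)}"

context
  fixes c :: "2 \<Rightarrow> real fps"
  assumes c_0: "\<And>i. c i $ 0 = 0"
begin

lemma weight_nth_eq_0: "n < length w \<Longrightarrow> weight c w $ n = 0"
proof (induction w arbitrary: n)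
  case (Cons i w)
  then have "c i $ k * weight c w $ (n - k) = 0" if "k \<le> n" for k
    using that c_0 by (cases k) auto
  then show ?case by (auto simp: fps_mult_nth intro!: sum.neutral)
qed simp

lemma locally_finite_weight: "locally_finite (weight c) I"
  unfolding locally_finite_def
proof
  fix n
  have "finite {w. set w \<subseteq> (UNIV :: 2 set) \<and> length w \<le> n}"
    by (rule finite_lists_length_le) simp
  then show "finite {w \<in> I. weight c w $ n \<noteq> 0}"
    by (rule finite_subset[rotated]) (use weight_nth_eq_0 in \<open>auto simp: not_less[symmetric]\<close>)
qed

lemma family_sum_weight_Cons: "family_sum (weight c) ((#) i ` I) = c i * family_sum (weight c) I"
proof -
  let ?f = "\<lambda>(u :: unit, w). c i * weight c w"
  have "family_sum (weight c) ((#) i ` I) = family_sum (weight c) ((\<lambda>(u, w). i # w) ` ({()} \<times> I))"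
    by (rule arg_cong[of _ _ "family_sum _"]) auto
  also have "\<dots> = family_sum ?f ({()} \<times> I)"
    by (subst family_sum_reindex) (simp_all add: inj_on_def case_prod_unfold)
  also have "\<dots> = family_sum (\<lambda>_. c i) {()} * family_sum (weight c) I"
    by (rule family_sum_Times(2)) (simp_all add: locally_finite_finite locally_finite_weight)
  finally show ?thesis by (simp add: family_sum_finite)
qed

lemma family_sum_weight_insert_Nil:
  "[] \<notin> I \<Longrightarrow> family_sum (weight c) (insert [] I) = 1 + family_sum (weight c) I"
  using family_sum_Un[of "weight c" "{[]}" I] by (simp add: locally_finite_weight family_sum_finite)

lemma family_sum_adm_words:
  "family_sum (weight c) adm_words = family_sum (weight c) adm_words1 * (1 + c 2)"
  "family_sum (weight c) adm_words1 = 1 + c 1 * family_sum (weight c) adm_words"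
proof -
  have "adm w \<longleftrightarrow> w \<in> adm_words1 \<union> (#) 2 ` adm_words1" for w
    by (cases w) (auto simp: successively_Cons neq_1_iff)
  then have "adm_words = adm_words1 \<union> (#) 2 ` adm_words1" by blast
  moreover have "adm_words1 \<inter> (#) 2 ` adm_words1 = {}"
    by (auto simp: neq_1_iff)
  ultimately show "family_sum (weight c) adm_words = family_sum (weight c) adm_words1 * (1 + c 2)"
    using family_sum_Un[of "weight c" adm_words1 "(#) 2 ` adm_words1"]
    by (auto simp: locally_finite_weight family_sum_weight_Cons algebra_simps)
  have "w \<in> adm_words1 \<longleftrightarrow> w \<in> insert [] ((#) 1 ` adm_words)" for w
    by (cases w) (auto simp: successively_Cons)
  then have "adm_words1 = insert [] ((#) 1 ` adm_words)" by blast
  then have "family_sum (weight c) adm_words1 = family_sum (weight c) (insert [] ((#) 1 ` adm_words))"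
    by (rule arg_cong)
  also have "\<dots> = 1 + family_sum (weight c) ((#) 1 ` adm_words)"
    by (rule family_sum_weight_insert_Nil) blast
  finally show "family_sum (weight c) adm_words1 = 1 + c 1 * family_sum (weight c) adm_words"
    unfolding family_sum_weight_Cons .
qed

lemma family_sum_loops1: "family_sum (weight c) loops1 = c 1 * family_sum (weight c) adm_words"
proof -
  have "k \<in> loops1 \<longleftrightarrow> k \<in> (#) 1 ` adm_words" for k
    by (cases k) (auto simp: successively_Cons successively_append_iff)
  then have "loops1 = (#) 1 ` adm_words" by blast
  then show ?thesis by (simp add: family_sum_weight_Cons)
qed

text \<open>
  A list that begins with 2 and may follow itself has the form \<open>2 # 1 # w\<close>, where \<open>w\<close> is empty or
  ends with 1.
\<close>

lemma family_sum_loops2: "(1 - c 1 - c 2 * c 1) * family_sum (weight c) loops2 = c 2 * c 1"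
proof -
  define Z where "Z = {w. adm w \<and> (w = [] \<or> last w = (1 :: 2))}"
  have "k \<in> loops2 \<longleftrightarrow> k \<in> (#) 2 ` (#) 1 ` Z" for k
    by (cases k; cases "tl k")
      (auto simp: Z_def successively_Cons successively_append_iff neq_1_iff)
  then have "loops2 = (#) 2 ` (#) 1 ` Z" by blast
  then have loops2: "family_sum (weight c) loops2 = c 2 * (c 1 * family_sum (weight c) Z)"
    by (simp add: family_sum_weight_Cons)
  have "w \<in> Z \<longleftrightarrow> w \<in> insert [] ((#) 1 ` Z \<union> (#) 2 ` (#) 1 ` Z)" for w
    using exhaust_2[of "hd w"]
    by (cases w; cases "tl w") (auto simp: Z_def successively_Cons neq_1_iff split: if_splits)
  then have "Z = insert [] ((#) 1 ` Z \<union> (#) 2 ` (#) 1 ` Z)" by blast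
  then have "family_sum (weight c) Z
      = family_sum (weight c) (insert [] ((#) 1 ` Z \<union> (#) 2 ` (#) 1 ` Z))"
    by (rule arg_cong)
  also have "\<dots> = 1 + family_sum (weight c) ((#) 1 ` Z \<union> (#) 2 ` (#) 1 ` Z)"
    by (rule family_sum_weight_insert_Nil) blast
  also have "family_sum (weight c) ((#) 1 ` Z \<union> (#) 2 ` (#) 1 ` Z)
      = family_sum (weight c) ((#) 1 ` Z) + family_sum (weight c) ((#) 2 ` (#) 1 ` Z)"
    by (rule family_sum_Un) (auto simp: locally_finite_weight neq_1_iff)
  finally have "family_sum (weight c) Z = 1 + (c 1 * family_sum (weight c) Z + c 2 * (c 1 * family_sum (weight c) Z))"
    unfolding family_sum_weight_Cons .
  then have "family_sum (weight c) Z
      - (c 1 * family_sum (weight c) Z + c 2 * (c 1 * family_sum (weight c) Z)) = 1"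
    by (simp only: diff_eq_eq)
  moreover have "(1 - c 1 - c 2 * c 1) * (c 2 * (c 1 * family_sum (weight c) Z))
      = c 2 * c 1 * (family_sum (weight c) Z
      - (c 1 * family_sum (weight c) Z + c 2 * (c 1 * family_sum (weight c) Z)))"
    by (simp add: algebra_simps)
  ultimately show ?thesis unfolding loops2 by simp
qed

end

section \<open>The cubic power series\<close>

text \<open>
  The solution \<open>\<xi>\<close> of \<open>\<xi> - \<xi>\<^sup>3 = z\<close> without constant term, and \<open>E = \<xi> / z\<close>. The words with
  normal form \<open>1\<close> turn out to be counted by \<open>E\<close>, and those with normal form \<open>t\<^sub>1 t\<^sub>1\<^sup>*\<close> by
  \<open>E\<^sup>2 - E\<close>.
\<close>

definition xi_fps :: "real fps" where
  "xi_fps = fps_inv (fps_X - fps_X ^ 3)"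

definition dyck_fps :: "real fps" where
  "dyck_fps = fps_shift 1 xi_fps"

lemma xi_fps_nth_0 [simp]: "xi_fps $ 0 = 0"
  by (simp add: xi_fps_def fps_inv_def)

lemma xi_fps_cubic: "xi_fps - xi_fps ^ 3 = fps_X"
proof -
  have "(fps_X - fps_X ^ 3) oo xi_fps = fps_X"
    unfolding xi_fps_def by (rule fps_inv_right) (simp_all add: fps_X_power_nth)
  then show ?thesis
    by (simp add: fps_compose_sub_distrib fps_compose_power[symmetric] fps_X_fps_compose_startby0)
qed

lemma xi_fps_eq: "xi_fps = fps_X * dyck_fps"
  by (rule fps_ext) (simp add: dyck_fps_def fps_X_mult_nth)

lemma dyck_fps_eq: "dyck_fps = 1 + fps_X\<^sup>2 * dyck_fps ^ 3"
proof -
  have "fps_X * (dyck_fps - fps_X\<^sup>2 * dyck_fps ^ 3) = xi_fps - xi_fps ^ 3"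
    unfolding xi_fps_eq by (simp add: algebra_simps power2_eq_square power3_eq_cube)
  then have "fps_X * (dyck_fps - fps_X\<^sup>2 * dyck_fps ^ 3) = fps_X * 1"
    by (simp add: xi_fps_cubic)
  then have "dyck_fps - fps_X\<^sup>2 * dyck_fps ^ 3 = 1"
    by (subst (asm) mult_left_cancel) simp_all
  then show ?thesis by (simp only: diff_eq_eq)
qed

lemma dyck_fps_square: "dyck_fps\<^sup>2 = 1 + fps_X\<^sup>2 * dyck_fps ^ 3 + fps_X\<^sup>2 * dyck_fps ^ 4"
proof -
  have "dyck_fps\<^sup>2 = dyck_fps * (1 + fps_X\<^sup>2 * dyck_fps ^ 3)"
    unfolding power2_eq_square[of dyck_fps] using dyck_fps_eq by (rule arg_cong)
  also have "\<dots> = dyck_fps + fps_X\<^sup>2 * dyck_fps ^ 4"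
    by (simp add: algebra_simps numeral_eq_Suc)
  also have "\<dots> = 1 + fps_X\<^sup>2 * dyck_fps ^ 3 + fps_X\<^sup>2 * dyck_fps ^ 4"
    using dyck_fps_eq by (rule arg_cong)
  finally show ?thesis .
qed

lemma dyck_fps_nth_0 [simp]: "dyck_fps $ 0 = 1"
  by (subst dyck_fps_eq) (simp add: fps_mult_nth_0)

section \<open>Counting words by normal form\<close>

definition wt_letter :: "2 \<Rightarrow> real fps" where
  "wt_letter i = (if i = 1 then fps_X * dyck_fps\<^sup>2 else fps_X * dyck_fps)"

definition wt_mid :: "bool \<Rightarrow> real fps" where
  "wt_mid p = (if p then dyck_fps\<^sup>2 - dyck_fps else dyck_fps)"

fun nf_fps :: "normal_form \<Rightarrow> real fps" where
  "nf_fps (m, p, n) = weight wt_letter m * weight wt_letter n * wt_mid p"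

lemma wt_letter_nth_0 [simp]: "wt_letter i $ 0 = 0"
  by (simp add: wt_letter_def)

lemma two_neq_one [simp]: "(2 :: 2) \<noteq> 1"
  by (simp add: neq_1_iff)

text \<open>
  This equation and the next two express how a word arises from a shorter one. A word whose
  normal form begins with \<open>\<beta>\<^sub>i\<close> arises by prepending \<open>\<beta>\<^sub>i\<close> or by cancelling a \<open>\<beta>\<^sub>1\<close> in front of \<open>\<beta>\<^sub>i\<close>; a
  cancelled \<open>\<beta>\<^sub>2\<close> is possible only if \<open>i = 1\<close>.
\<close>

lemma wt_letter_eq:
  "wt_letter i = fps_X * (1 + wt_letter 1 * wt_letter i
    + (if i = 1 then wt_letter 2 * wt_letter 1 else 0))"
proof (cases "i = 1")
  case True
  have "1 + wt_letter 1 * wt_letter 1 + wt_letter 2 * wt_letter 1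
      = 1 + fps_X\<^sup>2 * dyck_fps ^ 3 + fps_X\<^sup>2 * dyck_fps ^ 4"
    by (simp add: wt_letter_def algebra_simps numeral_eq_Suc)
  also have "\<dots> = dyck_fps\<^sup>2"
    by (rule dyck_fps_square[symmetric])
  finally show ?thesis using True by (simp add: wt_letter_def)
next
  case False
  have "1 + wt_letter 1 * wt_letter 2 = 1 + fps_X\<^sup>2 * dyck_fps ^ 3"
    by (simp add: wt_letter_def algebra_simps numeral_eq_Suc)
  also have "\<dots> = dyck_fps"
    by (rule dyck_fps_eq[symmetric])
  finally show ?thesis using False by (simp add: wt_letter_def)
qed

lemma wt_mid_False_eq: "wt_mid False = 1 + fps_X * (wt_letter 1 * wt_mid False)"
proof -
  have "fps_X * (wt_letter 1 * wt_mid False) = fps_X\<^sup>2 * dyck_fps ^ 3"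
    by (simp add: wt_mid_def wt_letter_def power2_eq_square power3_eq_cube)
  then show ?thesis using dyck_fps_eq by (simp add: wt_mid_def)
qed

lemma wt_mid_True_eq:
  "wt_mid True = fps_X * (wt_letter 1 * wt_mid True + wt_letter 2 * (wt_mid True + wt_mid False))"
proof -
  have "fps_X * (wt_letter 1 * wt_mid True + wt_letter 2 * (wt_mid True + wt_mid False))
      = fps_X\<^sup>2 * dyck_fps ^ 4"
    by (simp add: wt_mid_def wt_letter_def algebra_simps numeral_eq_Suc)
  then show ?thesis using dyck_fps_square dyck_fps_eq by (simp add: wt_mid_def)
qed

lemma UNIV_letter: "(UNIV :: 2 letter set) = {Alpha 1, Alpha 2, Beta 1, Beta 2}"
proof -
  have "l \<in> {Alpha 1, Alpha 2, Beta 1, Beta 2}" for l :: "2 letter"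
    by (cases l) (use exhaust_2 in auto)
  then show ?thesis by blast
qed

lemma finite_words: "finite {w :: 2 letter list. length w = N \<and> P w}"
proof (rule finite_subset)
  show "finite {w :: 2 letter list. set w \<subseteq> UNIV \<and> length w = N}"
    by (rule finite_lists_length_eq) (simp add: UNIV_letter)
qed auto

definition nf_count :: "nat \<Rightarrow> normal_form \<Rightarrow> real" where
  "nf_count N s = real (card {w. length w = N \<and> nf w = Some s})"

lemma nf_count_not_adm: "\<not> adm m \<Longrightarrow> nf_count N (m, p, n) = 0"
proof -
  assume "\<not> adm m"
  then have empty: "{w. length w = N \<and> nf w = Some (m, p, n)} = {}" using nf_adm by blast
  show ?thesis unfolding nf_count_def empty by simp
qed

lemma card_words_nf:
  assumes "finite S"
  shows "real (card {w. length w = N \<and> (\<exists>s\<in>S. nf w = Some s)}) = (\<Sum>s\<in>S. nf_count N s)"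
proof -
  have "{w. length w = N \<and> (\<exists>s\<in>S. nf w = Some s)} = (\<Union>s\<in>S. {w. length w = N \<and> nf w = Some s})"
    by auto
  also have "card \<dots> = (\<Sum>s\<in>S. card {w. length w = N \<and> nf w = Some s})"
    by (rule card_UN_disjoint) (use assms finite_words in auto)
  finally show ?thesis by (simp add: nf_count_def)
qed

lemma nf_count_Suc:
  assumes "\<And>l. finite (S l)" "\<And>l s'. nf_cons l s' = Some s \<longleftrightarrow> s' \<in> S l"
  shows "nf_count (Suc N) s = (\<Sum>l\<in>UNIV. \<Sum>s'\<in>S l. nf_count N s')"
proof -
  let ?W = "\<lambda>l. {w. length w = N \<and> (\<exists>s'\<in>S l. nf w = Some s')}"
  have "{w. length w = Suc N \<and> nf w = Some s} = (\<Union>l\<in>UNIV. (#) l ` ?W l)"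
    using assms(2) by (auto simp: length_Suc_conv bind_eq_Some_conv) blast
  moreover have "card (\<Union>l\<in>UNIV. (#) l ` ?W l) = (\<Sum>l\<in>UNIV. card ((#) l ` ?W l))"
    by (rule card_UN_disjoint) (use finite_words in \<open>auto simp: UNIV_letter\<close>)
  ultimately show ?thesis
    by (simp add: nf_count_def card_image card_words_nf[OF assms(1), unfolded nf_count_def])
qed

lemma nf_cons_eq_Some_Cons:
  "nf_cons l s' = Some (j # m, p, n) \<longleftrightarrow> s' \<in> (case l of
      Alpha i \<Rightarrow> {(i # j # m, p, n)}
    | Beta i \<Rightarrow> if i = j \<and> adm (j # m) then {(m, p, n)} else {})"
  by (cases "(l, s')" rule: nf_cons.cases) auto

lemma nf_cons_eq_Some_Nil_False:
  "nf_cons l s' = Some ([], False, n) \<longleftrightarrow> s' \<in> (case l of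
      Alpha i \<Rightarrow> (if i = 1 then {([1], False, n)} else {}) \<union>
        (if n \<noteq> [] \<and> hd n = i \<and> adm n
         then {([], False, tl n)} \<union> (if i = 1 then {([], True, tl n)} else {}) else {})
    | Beta i \<Rightarrow> {})"
  by (cases "(l, s')" rule: nf_cons.cases; cases n) (auto simp: neq_1_iff)

lemma nf_cons_eq_Some_Nil_True:
  "nf_cons l s' = Some ([], True, n) \<longleftrightarrow> s' \<in> (case l of
      Alpha i \<Rightarrow> if i = 1 then {([1], True, n)} else {([2], True, n), ([2], False, n)}
    | Beta i \<Rightarrow> {})"
  by (cases "(l, s')" rule: nf_cons.cases) (auto simp: neq_1_iff)

text \<open>
  Both sides satisfy the same recursion in \<open>N\<close>: a word of length \<open>N + 1\<close> with normal form \<open>s\<close> is a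
  letter followed by a word whose normal form is one of the at most three predecessors of \<open>s\<close>.
\<close>

lemma nf_count_eq:
  assumes "adm m" "adm n"
  shows "nf_count N (m, p, n) = nf_fps (m, p, n) $ N"
  using assms
proof (induction N arbitrary: m p n)
  case 0
  have words: "{w. length w = 0 \<and> nf w = Some (m, p, n)}
      = (if m = [] \<and> \<not> p \<and> n = [] then {[]} else {})" by auto
  have weight: "weight wt_letter k $ 0 = (if k = [] then 1 else 0)" for k
    by (cases k) (simp_all add: fps_mult_nth_0)
  have "nf_fps (m, p, n) $ 0 = (if m = [] \<and> \<not> p \<and> n = [] then 1 else 0)"
    by (simp add: weight fps_mult_nth_0 wt_mid_def power2_eq_square)
  then show ?case unfolding nf_count_def words by simp
next
  case (Suc N)
  have letters: "(\<Sum>l\<in>UNIV. f l) = f (Alpha 1) + f (Alpha 2) + f (Beta 1) + f (Beta 2)"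
    for f :: "2 letter \<Rightarrow> real"
    by (simp add: UNIV_letter)
  have X: "f $ N = (fps_X * f) $ Suc N" for f :: "real fps" by simp
  show ?case
  proof (cases m)
    case (Cons j m')
    let ?R = "weight wt_letter m' * weight wt_letter n * wt_mid p"
    have adm: "adm m'" "adm (1 # j # m')" "j = 1 \<Longrightarrow> adm (2 # j # m')" "\<not> j = 1 \<Longrightarrow> \<not> adm (2 # j # m')"
      using Suc.prems(1) Cons by (auto simp: successively_Cons)
    have "nf_count (Suc N) (j # m', p, n) = nf_count N (1 # j # m', p, n)
        + nf_count N (2 # j # m', p, n) + nf_count N (m', p, n)"
      using exhaust_2[of j] Suc.prems(1) Cons
      by (subst nf_count_Suc[OF _ nf_cons_eq_Some_Cons]) (auto simp: letters split: letter.split)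
    also have "nf_count N (2 # j # m', p, n)
        = (if j = 1 then wt_letter 2 * wt_letter 1 * ?R else 0) $ N"
      using adm Suc by (auto simp: nf_count_not_adm mult.assoc)
    also have "nf_count N (1 # j # m', p, n) = (wt_letter 1 * wt_letter j * ?R) $ N"
      using adm Suc by (simp add: mult.assoc)
    also have "nf_count N (m', p, n) = ?R $ N"
      using adm Suc by simp
    finally have "nf_count (Suc N) (j # m', p, n) = (fps_X * (wt_letter 1 * wt_letter j * ?R +
        (if j = 1 then wt_letter 2 * wt_letter 1 * ?R else 0) + ?R)) $ Suc N"
      by simp
    also have "fps_X * (wt_letter 1 * wt_letter j * ?R +
        (if j = 1 then wt_letter 2 * wt_letter 1 * ?R else 0) + ?R)
      = fps_X * (1 + wt_letter 1 * wt_letter j + (if j = 1 then wt_letter 2 * wt_letter 1 else 0)) * ?R"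
      by (simp add: algebra_simps)
    also have "\<dots> = wt_letter j * ?R"
      by (subst wt_letter_eq[of j]) simp
    finally show ?thesis by (simp add: Cons mult.assoc)
  next
    case Nil
    show ?thesis
    proof (cases p)
      case True
      have "nf_count (Suc N) ([], True, n)
          = nf_count N ([1], True, n) + (nf_count N ([2], True, n) + nf_count N ([2], False, n))"
        by (subst nf_count_Suc[OF _ nf_cons_eq_Some_Nil_True]) (auto simp: letters split: letter.split)
      also have "\<dots> = (fps_X * ((wt_letter 1 * wt_mid True + wt_letter 2 * (wt_mid True + wt_mid False))
          * weight wt_letter n)) $ Suc N"
        using Suc by (simp add: algebra_simps)
      also have "\<dots> = (wt_mid True * weight wt_letter n) $ Suc N"
        by (subst (3) wt_mid_True_eq) (simp only: mult.assoc)
      finally show ?thesis by (simp add: True Nil mult.commute)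
    next
      case False
      show ?thesis
      proof (cases n)
        case n: Nil
        have "nf_count (Suc N) ([], False, []) = nf_count N ([1], False, [])"
          by (subst nf_count_Suc[OF _ nf_cons_eq_Some_Nil_False]) (auto simp: letters split: letter.split)
        also have "\<dots> = (1 + fps_X * (wt_letter 1 * wt_mid False)) $ Suc N"
          using Suc by simp
        finally show ?thesis using False Nil n by (simp flip: wt_mid_False_eq)
      next
        case n: (Cons j n')
        have adm: "adm n'" using Suc.prems(2) n by (cases n') (simp_all add: successively_Cons)
        have "nf_count (Suc N) ([], False, j # n') = nf_count N ([1], False, j # n')
            + nf_count N ([], False, n') + (if j = 1 then nf_count N ([], True, n') else 0)"
          using exhaust_2[of j] Suc.prems(2) n
          by (subst nf_count_Suc[OF _ nf_cons_eq_Some_Nil_False]) (auto simp: letters split: letter.split)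
        also have "\<dots> = (fps_X * (wt_letter 1 * wt_letter j * wt_mid False
            + wt_mid False + (if j = 1 then wt_mid True else 0)) * weight wt_letter n') $ Suc N"
          using Suc adm n by (simp add: algebra_simps)
        also have "fps_X * (wt_letter 1 * wt_letter j * wt_mid False
            + wt_mid False + (if j = 1 then wt_mid True else 0)) = wt_letter j * wt_mid False"
          (is "?l = _")
        proof -
          have "fps_X * (wt_mid False + (if j = 1 then wt_mid True else 0)) = wt_letter j"
            by (simp add: wt_mid_def wt_letter_def)
          then have "?l = wt_letter j * (1 + fps_X * (wt_letter 1 * wt_mid False))"
            by (simp add: algebra_simps)
          then show ?thesis by (simp flip: wt_mid_False_eq)
        qed
        finally show ?thesis using False Nil n by (simp add: mult_ac)
      qed
    qed
  qed
qed

section \<open>The generating function of the periodic words\<close>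

definition recurrent_nfs :: "normal_form set" where
  "recurrent_nfs = {(m, p, n). adm m \<and> adm n \<and> recurrent (m, p, n)}"

lemma recurrent_words_fps:
  "locally_finite nf_fps recurrent_nfs"
  "Abs_fps (\<lambda>N. real (card (recurrent_words N))) = family_sum nf_fps recurrent_nfs"
proof -
  have count: "nf_fps s $ N = nf_count N s" if "s \<in> recurrent_nfs" for s N
    using that nf_count_eq by (auto simp: recurrent_nfs_def)
  have supp: "{s \<in> recurrent_nfs. nf_fps s $ N \<noteq> 0} \<subseteq> (\<lambda>w. the (nf w)) ` recurrent_words N" for N
  proof
    fix s assume s: "s \<in> {s \<in> recurrent_nfs. nf_fps s $ N \<noteq> 0}"
    then have "{w. length w = N \<and> nf w = Some s} \<noteq> {}"
      using count[of s N] by (auto simp: nf_count_def simp del: Collect_empty_eq)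
    then obtain w where w: "length w = N" "nf w = Some s" by blast
    have "recurrent s" using s by (auto simp: recurrent_nfs_def)
    then have "w \<in> recurrent_words N" using w unfolding recurrent_words_def by blast
    then show "s \<in> (\<lambda>w. the (nf w)) ` recurrent_words N"
      using w(2) by (intro image_eqI[of _ _ w]) auto
  qed
  have fin: "finite {s \<in> recurrent_nfs. nf_fps s $ N \<noteq> 0}" for N
    by (rule finite_subset[OF supp]) (simp add: recurrent_words_def finite_words)
  then show "locally_finite nf_fps recurrent_nfs" by (simp add: locally_finite_def)
  show "Abs_fps (\<lambda>N. real (card (recurrent_words N))) = family_sum nf_fps recurrent_nfs"
  proof (rule fps_ext)
    fix N
    let ?S = "{s \<in> recurrent_nfs. nf_fps s $ N \<noteq> 0}"
    have "w \<in> recurrent_words N \<longleftrightarrow> length w = N \<and> (\<exists>s\<in>?S. nf w = Some s)" for w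
    proof
      assume w: "w \<in> recurrent_words N"
      then obtain s where s: "nf w = Some s" "recurrent s" "length w = N"
        by (auto simp: recurrent_words_def)
      then have mem: "s \<in> recurrent_nfs"
        using nf_adm by (cases s) (auto simp: recurrent_nfs_def)
      have "card {w. length w = N \<and> nf w = Some s} \<noteq> 0"
        using s finite_words[of N "\<lambda>w. nf w = Some s"] by auto
      then have "s \<in> ?S" using mem count[OF mem, of N] by (simp add: nf_count_def)
      then show "length w = N \<and> (\<exists>s\<in>?S. nf w = Some s)" using s by blast
    qed (auto simp: recurrent_words_def recurrent_nfs_def)
    then have "recurrent_words N = {w. length w = N \<and> (\<exists>s\<in>?S. nf w = Some s)}" by blast
    then have "real (card (recurrent_words N)) = (\<Sum>s\<in>?S. nf_count N s)"
      using card_words_nf[OF fin] by simp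
    also have "\<dots> = (\<Sum>s\<in>?S. nf_fps s $ N)"
      using count by (intro sum.cong) auto
    also have "\<dots> = family_sum nf_fps recurrent_nfs $ N"
      using fin by (intro family_sum_nth[symmetric]) auto
    finally show "Abs_fps (\<lambda>N. real (card (recurrent_words N))) $ N = family_sum nf_fps recurrent_nfs $ N"
      by simp
  qed
qed

text \<open>
  Apart from the neutral normal forms with \<open>m = rev n\<close>, the recurrent ones are given by the shorter
  of the two lists and the rest \<open>k\<close> of the longer one. If \<open>k\<close> begins with 2, the list before it must
  not end with 2, and \<open>e\<close> must be \<open>1\<close>.
\<close>

definition drift_index :: "(2 list \<times> 2 list \<times> bool) set" where
  "drift_index = adm_words \<times> (loops1 \<times> UNIV) \<union> adm_words1 \<times> (loops2 \<times> {False})"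

lemma mem_drift_index:
  "(n, k, p) \<in> drift_index \<longleftrightarrow>
    k \<noteq> [] \<and> adm n \<and> adm (rev n @ k) \<and> adm (k @ k) \<and> (p \<longrightarrow> hd k = 1)"
  by (auto simp: drift_index_def adm_rev successively_append_iff last_rev simp del: successively_rev)

definition neutral_nf :: "2 list \<times> bool \<Rightarrow> normal_form" where
  "neutral_nf = (\<lambda>(n, p). (rev n, p, n))"

definition beta_drift_nf :: "2 list \<times> 2 list \<times> bool \<Rightarrow> normal_form" where
  "beta_drift_nf = (\<lambda>(n, k, p). (rev n @ k, p, n))"

definition alpha_drift_nf :: "2 list \<times> 2 list \<times> bool \<Rightarrow> normal_form" where
  "alpha_drift_nf = (\<lambda>(n, k, p). (rev n, p, rev k @ n))"

lemma recurrent_nfs_eq: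
  "recurrent_nfs = neutral_nf ` (adm_words \<times> UNIV)
    \<union> (beta_drift_nf ` drift_index \<union> alpha_drift_nf ` drift_index)"
proof (rule Set.set_eqI)
  fix s :: normal_form
  obtain m p n where s: "s = (m, p, n)" by (cases s)
  have neutral: "s \<in> neutral_nf ` (adm_words \<times> UNIV) \<longleftrightarrow> adm n \<and> m = rev n"
    by (auto simp: s neutral_nf_def image_iff)
  have beta: "s \<in> beta_drift_nf ` drift_index \<longleftrightarrow> (\<exists>k. (n, k, p) \<in> drift_index \<and> m = rev n @ k)"
    by (auto simp: s beta_drift_nf_def image_iff split: prod.splits) blast+
  have alpha: "s \<in> alpha_drift_nf ` drift_index
      \<longleftrightarrow> (\<exists>k. (rev m, k, p) \<in> drift_index \<and> rev n = m @ k)"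
  proof
    assume "s \<in> alpha_drift_nf ` drift_index"
    then show "\<exists>k. (rev m, k, p) \<in> drift_index \<and> rev n = m @ k"
      by (auto simp: s alpha_drift_nf_def)
  next
    assume "\<exists>k. (rev m, k, p) \<in> drift_index \<and> rev n = m @ k"
    then obtain k where k: "(rev m, k, p) \<in> drift_index" "rev n = m @ k" by blast
    from arg_cong[OF k(2), of rev] have "s = alpha_drift_nf (rev m, k, p)"
      by (simp add: s alpha_drift_nf_def)
    then show "s \<in> alpha_drift_nf ` drift_index" using k(1) by blast
  qed
  have "s \<in> recurrent_nfs \<longleftrightarrow> adm m \<and> adm n \<and>
      (\<exists>k. adm (k @ k) \<and> (p \<longrightarrow> k = [] \<or> hd k = 1) \<and> (m = rev n @ k \<or> rev n = m @ k))"
    by (simp add: s recurrent_nfs_def recurrent.simps)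
  also have "\<dots> \<longleftrightarrow> (adm n \<and> m = rev n) \<or> (\<exists>k. (n, k, p) \<in> drift_index \<and> m = rev n @ k) \<or>
      (\<exists>k. (rev m, k, p) \<in> drift_index \<and> rev n = m @ k)"
    (is "?l \<longleftrightarrow> ?r")
  proof
    assume ?l
    then obtain k where k: "adm m" "adm n" "adm (k @ k)" "p \<longrightarrow> k = [] \<or> hd k = 1"
      "m = rev n @ k \<or> rev n = m @ k" by blast
    have rev: "adm (rev m)" "adm (rev n)" using k adm_rev by blast+
    show ?r
    proof (cases "k = []")
      case True
      then show ?thesis using k by auto
    next
      case False
      have "adm (rev (rev m) @ k)" if "rev n = m @ k" using rev(2) that by simp
      then show ?thesis
        using k rev(1) False unfolding mem_drift_index by blast
    qed
  next
    assume ?r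
    then show ?l
    proof (elim disjE exE conjE)
      assume "adm n" "m = rev n"
      then show ?l using adm_rev[of n] by (auto intro!: exI[of _ "[]"])
    next
      fix k assume "(n, k, p) \<in> drift_index" "m = rev n @ k"
      then show ?l by (auto simp: mem_drift_index intro!: exI[of _ k])
    next
      fix k assume k: "(rev m, k, p) \<in> drift_index" "rev n = m @ k"
      then have "adm n" "adm m"
        using adm_rev[of n] adm_rev[of m] by (auto simp: mem_drift_index)
      then show ?l using k by (auto simp: mem_drift_index intro!: exI[of _ k])
    qed
  qed
  finally show "s \<in> recurrent_nfs \<longleftrightarrow> s \<in> neutral_nf ` (adm_words \<times> UNIV)
      \<union> (beta_drift_nf ` drift_index \<union> alpha_drift_nf ` drift_index)"
    by (simp add: neutral beta alpha)
qed

abbreviation "wt_sq \<equiv> weight (\<lambda>i. (wt_letter i)\<^sup>2)"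

lemma wt_sq_eq: "wt_sq w = weight wt_letter w * weight wt_letter w"
  unfolding weight_square by (rule power2_eq_square)

lemma wt_sq_locally_finite: "locally_finite wt_sq I"
  by (rule locally_finite_weight) (simp add: power2_eq_square)

lemma recurrent_nfs_sum:
  "family_sum nf_fps recurrent_nfs = family_sum wt_sq adm_words * dyck_fps\<^sup>2
    + 2 * (family_sum wt_sq adm_words * (family_sum (weight wt_letter) loops1 * dyck_fps\<^sup>2)
    + family_sum wt_sq adm_words1 * (family_sum (weight wt_letter) loops2 * dyck_fps))"
proof -
  let ?h = "\<lambda>(n, k, p). wt_sq n * (weight wt_letter k * wt_mid p)"
  have lf: "locally_finite wt_sq I" "locally_finite (weight wt_letter) I" for I
    by (rule wt_sq_locally_finite, rule locally_finite_weight) simp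
  have mid: "family_sum wt_mid UNIV = dyck_fps\<^sup>2" "family_sum wt_mid {False} = dyck_fps"
    by (simp_all add: family_sum_finite UNIV_bool wt_mid_def)
  have disj: "neutral_nf ` (adm_words \<times> UNIV) \<inter> (beta_drift_nf ` drift_index \<union> alpha_drift_nf ` drift_index) = {}"
    "beta_drift_nf ` drift_index \<inter> alpha_drift_nf ` drift_index = {}"
    by (auto simp: neutral_nf_def beta_drift_nf_def alpha_drift_nf_def mem_drift_index
        dest!: arg_cong[of _ _ length])
  have inj: "inj_on neutral_nf (adm_words \<times> UNIV)" "inj_on beta_drift_nf drift_index"
    "inj_on alpha_drift_nf drift_index"
    by (auto simp: inj_on_def neutral_nf_def beta_drift_nf_def alpha_drift_nf_def)
  have "family_sum nf_fps (neutral_nf ` (adm_words \<times> UNIV))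
      = family_sum (\<lambda>(n, p). wt_sq n * wt_mid p) (adm_words \<times> UNIV)"
    unfolding family_sum_reindex[OF inj(1)]
    by (intro family_sum_cong) (auto simp: neutral_nf_def wt_sq_eq)
  also have "\<dots> = family_sum wt_sq adm_words * family_sum wt_mid UNIV"
    by (rule family_sum_Times(2)) (simp_all add: lf locally_finite_finite)
  finally have neutral: "family_sum nf_fps (neutral_nf ` (adm_words \<times> UNIV))
      = family_sum wt_sq adm_words * dyck_fps\<^sup>2" by (simp add: mid)
  have times: "locally_finite ?h (I \<times> (K \<times> P))"
    "family_sum ?h (I \<times> (K \<times> P))
      = family_sum wt_sq I * (family_sum (weight wt_letter) K * family_sum wt_mid P)" for I K P
  proof -
    have P: "locally_finite wt_mid P" by (rule locally_finite_finite) simp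
    note KP = family_sum_Times[OF lf(2) P, of K]
    show "locally_finite ?h (I \<times> (K \<times> P))"
      using family_sum_Times(1)[OF lf(1) KP(1), of I] by (simp add: case_prod_unfold)
    show "family_sum ?h (I \<times> (K \<times> P))
      = family_sum wt_sq I * (family_sum (weight wt_letter) K * family_sum wt_mid P)"
      using family_sum_Times(2)[OF lf(1) KP(1), of I] KP(2) by (simp add: case_prod_unfold)
  qed
  have "family_sum ?h drift_index
      = family_sum ?h (adm_words \<times> (loops1 \<times> UNIV)) + family_sum ?h (adm_words1 \<times> (loops2 \<times> {False}))"
    unfolding drift_index_def by (rule family_sum_Un[OF times(1) times(1)]) auto
  also have "\<dots> = family_sum wt_sq adm_words * (family_sum (weight wt_letter) loops1 * dyck_fps\<^sup>2)
    + family_sum wt_sq adm_words1 * (family_sum (weight wt_letter) loops2 * dyck_fps)"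
    by (simp only: times(2) mid)
  finally have drift: "family_sum ?h drift_index =
      family_sum wt_sq adm_words * (family_sum (weight wt_letter) loops1 * dyck_fps\<^sup>2)
    + family_sum wt_sq adm_words1 * (family_sum (weight wt_letter) loops2 * dyck_fps)" .
  have "family_sum nf_fps (beta_drift_nf ` drift_index) = family_sum ?h drift_index"
    "family_sum nf_fps (alpha_drift_nf ` drift_index) = family_sum ?h drift_index"
    unfolding family_sum_reindex[OF inj(2)] family_sum_reindex[OF inj(3)]
    by (auto intro!: family_sum_cong simp: beta_drift_nf_def alpha_drift_nf_def wt_sq_eq mult_ac)
  moreover have "family_sum nf_fps recurrent_nfs = family_sum nf_fps (neutral_nf ` (adm_words \<times> UNIV))
      + (family_sum nf_fps (beta_drift_nf ` drift_index) + family_sum nf_fps (alpha_drift_nf ` drift_index))"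
  proof -
    have sub: "locally_finite nf_fps I" if "I \<subseteq> recurrent_nfs" for I
      using locally_finite_subset[OF recurrent_words_fps(1) that] .
    have "family_sum nf_fps recurrent_nfs = family_sum nf_fps (neutral_nf ` (adm_words \<times> UNIV))
        + family_sum nf_fps (beta_drift_nf ` drift_index \<union> alpha_drift_nf ` drift_index)"
      unfolding recurrent_nfs_eq
      by (rule family_sum_Un[OF sub sub disj(1)]) (auto simp: recurrent_nfs_eq)
    also have "family_sum nf_fps (beta_drift_nf ` drift_index \<union> alpha_drift_nf ` drift_index)
        = family_sum nf_fps (beta_drift_nf ` drift_index) + family_sum nf_fps (alpha_drift_nf ` drift_index)"
      by (rule family_sum_Un[OF sub sub disj(2)]) (auto simp: recurrent_nfs_eq)
    finally show ?thesis .
  qed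
  ultimately show ?thesis by (simp add: neutral drift)
qed

text \<open>
  All the sums are rational functions of \<open>x\<close>: one has \<open>E = 1 / (1 - x\<^sup>2)\<close>,
  \<open>O2 = (1 - x\<^sup>2)\<^sup>2 / (1 - 3x\<^sup>2)\<close>, \<open>L1 = (x + x\<^sup>2) / (1 - x - 2x\<^sup>2)\<close> and \<open>L2 = x\<^sup>2 / (1 - x - 2x\<^sup>2)\<close>.
\<close>

lemma rational_identity:
  fixes x :: "'a :: idom"
  assumes E: "(1 - x\<^sup>2) * E = 1"
    and T: "T = O2 * (1 + x\<^sup>2)" and O2: "O2 = 1 + (x * E)\<^sup>2 * T"
    and S: "S = O1 * (1 + x)" and O1: "O1 = 1 + x * E * S"
    and L1: "L1 = x * E * S" and L2: "(1 - x * E - x * (x * E)) * L2 = x * (x * E)"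
  shows "(T * E\<^sup>2 + 2 * (T * (L1 * E\<^sup>2) + O2 * (L2 * E)) - 1) * (1 - 3 * x\<^sup>2) * (1 - x - 2 * x\<^sup>2)
    = 2 * (x - x ^ 3) * (1 + 4 * x)"
proof -
  have O2': "O2 * (1 - 3 * x\<^sup>2) = (1 - x\<^sup>2)\<^sup>2"
    using E T O2 by Groebner_Basis.algebra
  have T': "T * E\<^sup>2 * (1 - 3 * x\<^sup>2) = 1 + x\<^sup>2"
    using E T O2' by Groebner_Basis.algebra
  have L1': "L1 * (1 - x - 2 * x\<^sup>2) = x + x\<^sup>2"
    using E S O1 L1 by Groebner_Basis.algebra
  have L2': "L2 * (1 - x - 2 * x\<^sup>2) = x\<^sup>2"
    using E L2 by Groebner_Basis.algebra
  have OE: "O2 * E * (1 - 3 * x\<^sup>2) = 1 - x\<^sup>2"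
    using E O2' by Groebner_Basis.algebra
  show ?thesis using T' L1' L2' OE by Groebner_Basis.algebra
qed

section \<open>Convergence of the cubic series\<close>

lemma fps_mult_nth_nonneg:
  fixes f g :: "real fps"
  assumes "\<And>k. k \<le> n \<Longrightarrow> 0 \<le> f $ k" "\<And>k. k \<le> n \<Longrightarrow> 0 \<le> g $ k"
  shows "0 \<le> (f * g) $ n"
  using assms by (auto simp: fps_mult_nth intro!: sum_nonneg)

lemma dyck_fps_nth_Suc_Suc: "dyck_fps $ Suc (Suc n) = (dyck_fps ^ 3) $ n"
proof -
  have "dyck_fps $ Suc (Suc n) = (1 + fps_X\<^sup>2 * dyck_fps ^ 3) $ Suc (Suc n)"
    using dyck_fps_eq by (rule arg_cong)
  then show ?thesis by (simp add: fps_X_power_mult_nth)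
qed

lemma dyck_fps_nth_Suc_0: "dyck_fps $ Suc 0 = 0"
proof -
  have "dyck_fps $ Suc 0 = (1 + fps_X\<^sup>2 * dyck_fps ^ 3) $ Suc 0"
    using dyck_fps_eq by (rule arg_cong)
  then show ?thesis by (simp add: fps_X_power_mult_nth)
qed

lemma dyck_fps_nonneg: "0 \<le> dyck_fps $ n"
proof (induction n rule: less_induct)
  case (less n)
  consider "n = 0" | "n = Suc 0" | m where "n = Suc (Suc m)"
    by (metis not0_implies_Suc)
  then show ?case
  proof cases
    case (3 m)
    have "0 \<le> (dyck_fps * (dyck_fps * dyck_fps)) $ m"
      using less 3 by (intro fps_mult_nth_nonneg) auto
    then show ?thesis using 3 by (simp add: dyck_fps_nth_Suc_Suc power3_eq_cube mult.assoc)
  qed (simp_all add: dyck_fps_nth_Suc_0)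
qed

lemma partial_sum_mult_le:
  fixes f g :: "real fps"
  assumes "\<And>k. 0 \<le> f $ k" "\<And>k. 0 \<le> g $ k" "0 \<le> r"
  shows "(\<Sum>k\<le>n. (f * g) $ k * r ^ k) \<le> (\<Sum>k\<le>n. f $ k * r ^ k) * (\<Sum>k\<le>n. g $ k * r ^ k)"
proof -
  have "(f * g) $ k * r ^ k = (\<Sum>i\<le>k. (f $ i * r ^ i) * (g $ (k - i) * r ^ (k - i)))" for k
    unfolding fps_mult_nth sum_distrib_right atLeast0AtMost
  proof (rule sum.cong)
    fix i assume "i \<in> {..k}"
    then have "r ^ k = r ^ i * r ^ (k - i)" by (simp flip: power_add)
    then show "f $ i * g $ (k - i) * r ^ k = f $ i * r ^ i * (g $ (k - i) * r ^ (k - i))" by simp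
  qed simp
  then have "(\<Sum>k\<le>n. (f * g) $ k * r ^ k)
      = (\<Sum>(i, j)\<in>{(i, j). i + j \<le> n}. (f $ i * r ^ i) * (g $ j * r ^ j))"
    by (simp add: sum.triangle_reindex_eq)
  also have "\<dots> \<le> (\<Sum>(i, j)\<in>{..n} \<times> {..n}. (f $ i * r ^ i) * (g $ j * r ^ j))"
    using assms by (intro sum_mono2) auto
  also have "\<dots> = (\<Sum>k\<le>n. f $ k * r ^ k) * (\<Sum>k\<le>n. g $ k * r ^ k)"
    by (simp add: sum_product sum.cartesian_product)
  finally show ?thesis .
qed

text \<open>
  By \<open>E = 1 + z\<^sup>2 E\<^sup>3\<close>, a bound 2 for the partial sums at \<open>z = 1/4\<close> yields \<open>1 + 2\<^sup>3 / 16 \<le> 2\<close> for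
  the later ones.
\<close>

lemma dyck_fps_partial_sum_le: "(\<Sum>k\<le>n. dyck_fps $ k * (1 / 4) ^ k) \<le> 2"
proof (induction n rule: less_induct)
  case (less n)
  let ?S = "\<lambda>f n. \<Sum>k\<le>n. f $ k * (1 / 4 :: real) ^ k"
  consider "n = 0" | "n = Suc 0" | m where "n = Suc (Suc m)"
    by (metis not0_implies_Suc)
  then show ?case
  proof cases
    case (3 m)
    have nonneg: "0 \<le> (dyck_fps * dyck_fps) $ k" for k
      by (intro fps_mult_nth_nonneg dyck_fps_nonneg)
    have S: "0 \<le> ?S dyck_fps m" "?S dyck_fps m \<le> 2"
      using less 3 by (auto intro!: sum_nonneg simp: dyck_fps_nonneg)
    have "?S (dyck_fps ^ 3) m = ?S (dyck_fps * (dyck_fps * dyck_fps)) m"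
      by (simp add: power3_eq_cube mult.assoc)
    also have "\<dots> \<le> ?S dyck_fps m * ?S (dyck_fps * dyck_fps) m"
      by (intro partial_sum_mult_le dyck_fps_nonneg nonneg) simp
    also have "\<dots> \<le> ?S dyck_fps m * (?S dyck_fps m * ?S dyck_fps m)"
      by (intro mult_left_mono partial_sum_mult_le dyck_fps_nonneg S) simp
    also have "\<dots> \<le> 2 * (2 * 2)"
      by (intro mult_mono S mult_nonneg_nonneg) simp_all
    finally have cube: "?S (dyck_fps ^ 3) m \<le> 8" by simp
    have "?S dyck_fps (Suc (Suc m)) = 1 + (\<Sum>k\<le>m. dyck_fps $ Suc (Suc k) * (1 / 4) ^ Suc (Suc k))"
      by (simp add: sum.atMost_Suc_shift dyck_fps_nth_Suc_0 del: sum.atMost_Suc)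
    also have "(\<Sum>k\<le>m. dyck_fps $ Suc (Suc k) * (1 / 4) ^ Suc (Suc k)) = ?S (dyck_fps ^ 3) m / 16"
      by (simp add: dyck_fps_nth_Suc_Suc sum_divide_distrib)
    finally show ?thesis using cube 3 by simp
  qed (simp_all add: dyck_fps_nth_Suc_0)
qed

lemma fps_conv_radius_xi_fps: "fps_conv_radius xi_fps > 0"
proof -
  have "summable (\<lambda>n. dyck_fps $ n * (1 / 4) ^ n)"
  proof (rule summableI_nonneg_bounded)
    show "(\<Sum>k<n. dyck_fps $ k * (1 / 4) ^ k) \<le> 2" for n
    proof (cases n)
      case (Suc m)
      then show ?thesis using dyck_fps_partial_sum_le[of m] by (simp add: lessThan_Suc_atMost)
    qed simp
  qed (simp add: dyck_fps_nonneg)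
  then have "ereal (norm (1 / 4 :: real)) \<le> conv_radius (fps_nth dyck_fps)"
    by (rule conv_radius_geI)
  moreover have "fps_conv_radius dyck_fps = fps_conv_radius xi_fps"
    by (simp add: dyck_fps_def)
  moreover have "0 < ereal (norm (1 / 4 :: real))" by simp
  ultimately show ?thesis
    unfolding fps_conv_radius_def by (metis less_le_trans)
qed

lemma sin_triple: "sin (3 * t) = 3 * sin t - 4 * sin t ^ 3" for t :: real
proof -
  have "sin (3 * t) = sin (2 * t + t)" by simp
  also have "\<dots> = 2 * sin t * (1 - (sin t)\<^sup>2) + (1 - 2 * (sin t)\<^sup>2) * sin t"
    unfolding sin_add by (simp add: sin_double cos_double_sin flip: cos_squared_eq)
      (simp add: power2_eq_square)
  finally show ?thesis by (simp add: algebra_simps power2_eq_square power3_eq_cube)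
qed

text \<open>
  With \<open>\<xi> = 2/\<surd>3 sin t\<close>, the formula for \<open>sin (3t)\<close> becomes \<open>\<xi> - \<xi>\<^sup>3 = 2/(3\<surd>3) sin (3t)\<close>.
\<close>

lemma xi_cubic:
  assumes "\<bar>z\<bar> < 1 / 4"
  shows "xi z - xi z ^ 3 = z"
proof -
  define t where "t = 1 / 3 * arcsin (3 * sqrt 3 / 2 * z)"
  have "sqrt 3 < sqrt (2\<^sup>2 :: real)" by (rule real_sqrt_less_mono) simp
  then have s: "0 < sqrt 3" "sqrt 3 < (2 :: real)" by simp_all
  have "\<bar>3 * sqrt 3 / 2 * z\<bar> = 3 * sqrt 3 / 2 * \<bar>z\<bar>" by (simp add: abs_mult)
  also have "\<dots> \<le> 3 * 2 / 2 * (1 / 4)" using s assms by (intro mult_mono) simp_all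
  finally have "\<bar>3 * sqrt 3 / 2 * z\<bar> \<le> 1" by simp
  then have "sin (3 * t) = 3 * sqrt 3 / 2 * z"
    by (simp add: t_def abs_le_iff)
  then have sin: "3 * sin t - 4 * sin t ^ 3 = 3 * sqrt 3 / 2 * z"
    by (simp add: sin_triple)
  have xi: "xi z = 2 / sqrt 3 * sin t" by (simp add: xi_def t_def)
  have cube: "sqrt 3 ^ 3 = 3 * sqrt 3" by (simp add: power3_eq_cube)
  have "xi z - xi z ^ 3 = 2 / (3 * sqrt 3) * (3 * sin t - 4 * sin t ^ 3)"
    unfolding xi power_mult_distrib power_divide cube by (simp add: field_simps)
  also have "\<dots> = z" unfolding sin by simp
  finally show ?thesis .
qed

lemma cubic_inj:
  fixes u v :: real
  assumes "u - u ^ 3 = v - v ^ 3" "\<bar>u\<bar> < 1 / 2" "\<bar>v\<bar> < 1 / 2"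
  shows "u = v"
proof (rule ccontr)
  assume "u \<noteq> v"
  have "(u - v) * (1 - (u * u + u * v + v * v)) = 0"
    using assms(1) by (simp add: algebra_simps power3_eq_cube)
  then have eq: "u * u + u * v + v * v = 1" using \<open>u \<noteq> v\<close> by simp
  have "\<bar>a * b\<bar> \<le> 1 / 2 * (1 / 2)" if "\<bar>a\<bar> < 1 / 2" "\<bar>b\<bar> < 1 / 2" for a b :: real
    unfolding abs_mult using that by (intro mult_mono) simp_all
  from this[OF assms(2) assms(2)] this[OF assms(2) assms(3)] this[OF assms(3) assms(3)]
  show False using eq by (simp add: abs_le_iff)
qed

text \<open>
  The sum of the series and the trigonometric function both tend to 0 at 0 and solve
  \<open>u - u\<^sup>3 = z\<close>, an equation with at most one solution of absolute value below \<open>1/2\<close>.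
\<close>

lemma xi_has_fps_expansion: "xi has_fps_expansion xi_fps"
proof -
  let ?F = "eval_fps xi_fps"
  have F: "?F has_fps_expansion xi_fps"
    by (rule eval_fps_has_fps_expansion[OF fps_conv_radius_xi_fps])
  have "(\<lambda>z. ?F z - ?F z * (?F z * ?F z)) has_fps_expansion xi_fps - xi_fps * (xi_fps * xi_fps)"
    by (intro fps_expansion_intros F)
  also have "xi_fps - xi_fps * (xi_fps * xi_fps) = fps_X"
    using xi_fps_cubic by (simp add: power3_eq_cube mult.assoc)
  finally have "\<forall>\<^sub>F z in nhds 0. z = ?F z - ?F z * (?F z * ?F z)"
    by (simp add: has_fps_expansion_def)
  moreover have "\<forall>\<^sub>F z in nhds 0. \<bar>?F z\<bar> < 1 / 2"
  proof -
    have "isCont ?F 0" by (rule has_fps_expansion_imp_continuous[OF F])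
    then have "(?F \<longlongrightarrow> ?F 0) (nhds 0)"
      by (simp add: isCont_def tendsto_at_iff_tendsto_nhds)
    then have "((\<lambda>z. \<bar>?F z\<bar>) \<longlongrightarrow> \<bar>?F 0\<bar>) (nhds 0)" by (rule tendsto_rabs)
    then show ?thesis by (rule order_tendstoD(2)) (simp add: eval_fps_at_0)
  qed
  moreover have "\<forall>\<^sub>F z in nhds 0. \<bar>xi z\<bar> < 1 / 2"
  proof -
    have "isCont (\<lambda>z. arcsin (3 * sqrt 3 / 2 * z)) 0"
      by (rule isCont_o2[where f = "\<lambda>z. 3 * sqrt 3 / 2 * z" and g = arcsin])
        (auto intro: isCont_arcsin continuous_intros)
    then have "isCont xi 0" unfolding xi_def by (intro continuous_intros)
    then have "(xi \<longlongrightarrow> xi 0) (nhds 0)"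
      by (simp add: isCont_def tendsto_at_iff_tendsto_nhds)
    then have "((\<lambda>z. \<bar>xi z\<bar>) \<longlongrightarrow> \<bar>xi 0\<bar>) (nhds 0)" by (rule tendsto_rabs)
    then show ?thesis by (rule order_tendstoD(2)) (simp add: xi_def)
  qed
  moreover have "\<forall>\<^sub>F z :: real in nhds 0. \<bar>z\<bar> < 1 / 4"
    using eventually_nhds_in_open[of "ball (0 :: real) (1 / 4)" 0] by (simp add: dist_real_def)
  ultimately have "\<forall>\<^sub>F z in nhds 0. ?F z = xi z"
  proof eventually_elim
    case (elim z)
    have "?F z - ?F z ^ 3 = ?F z - ?F z * (?F z * ?F z)"
      by (simp add: power3_eq_cube mult.assoc)
    also have "\<dots> = z" using elim(1) by (rule sym)
    also have "\<dots> = xi z - xi z ^ 3" using xi_cubic[OF elim(4)] by (rule sym)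
    finally show ?case using elim(2,3) by (rule cubic_inj)
  qed
  then show ?thesis by (simp add: has_fps_expansion_def fps_conv_radius_xi_fps)
qed

section \<open>The zeta function\<close>

lemma periodic_words_identity:
  "(Abs_fps (\<lambda>N. real (card (recurrent_words N))) - 1) * (1 - 3 * xi_fps\<^sup>2) * (1 - xi_fps - 2 * xi_fps\<^sup>2)
    = 2 * fps_X * (1 + 4 * xi_fps)"
proof -
  have "fps_X * ((1 - xi_fps\<^sup>2) * dyck_fps) = xi_fps - xi_fps ^ 3"
    by (simp add: xi_fps_eq algebra_simps power2_eq_square power3_eq_cube)
  then have E: "(1 - xi_fps\<^sup>2) * dyck_fps = 1"
    by (simp add: xi_fps_cubic)
  have wt: "wt_letter 1 = xi_fps * dyck_fps" "wt_letter 2 = xi_fps"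
    by (simp_all add: wt_letter_def xi_fps_eq power2_eq_square)
  have sq_0: "(wt_letter i)\<^sup>2 $ 0 = 0" for i by (simp add: power2_eq_square)
  note S = family_sum_adm_words[of wt_letter, OF wt_letter_nth_0, unfolded wt]
  note T = family_sum_adm_words[of "\<lambda>i. (wt_letter i)\<^sup>2", OF sq_0, unfolded wt]
  note L1 = family_sum_loops1[of wt_letter, OF wt_letter_nth_0, unfolded wt]
  note L2 = family_sum_loops2[of wt_letter, OF wt_letter_nth_0, unfolded wt]
  show ?thesis
    unfolding recurrent_words_fps(2) recurrent_nfs_sum rational_identity[OF E T S L1 L2] xi_fps_cubic ..
qed

text \<open>
  Let \<open>u = 1 - \<xi> - 2\<xi>\<^sup>2\<close>. The logarithmic derivative of the zeta function is \<open>(P - 1) / z\<close>, and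
  \<open>periodic_words_identity\<close> identifies it with \<open>-2 u' / u\<close>. So the product of the zeta function
  with \<open>u\<^sup>2\<close> has derivative 0.
\<close>

lemma zeta_series_eq:
  "zeta_series (markov_dyck_shift A_G2) = inverse ((1 - xi_fps - 2 * xi_fps\<^sup>2) * (1 - xi_fps - 2 * xi_fps\<^sup>2))"
proof -
  define u where "u = 1 - xi_fps - 2 * xi_fps\<^sup>2"
  define v where "v = 1 - 3 * xi_fps\<^sup>2"
  define P where "P = Abs_fps (\<lambda>N. real (card (recurrent_words N)))"
  define L where "L = Abs_fps (\<lambda>n. if n = 0 then 0
    else real (card (periodic_pts (markov_dyck_shift A_G2) n)) / real n)"
  define Z where "Z = fps_exp 1 oo L"
  have identity: "(P - 1) * v * u = 2 * fps_X * (1 + 4 * xi_fps)"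
    using periodic_words_identity by (simp add: P_def u_def v_def)
  have u_0: "u $ 0 = 1" and v_0: "v $ 0 = 1"
    by (simp_all add: u_def v_def power2_eq_square)
  have P_0: "P $ 0 = 1"
    using arg_cong[OF identity, of "\<lambda>f. f $ 0"] by (simp add: u_0 v_0)
  have L: "fps_X * fps_deriv L = P - 1"
  proof (rule fps_ext)
    fix n
    show "(fps_X * fps_deriv L) $ n = (P - 1) $ n"
    proof (cases n)
      case 0
      then show ?thesis by (simp add: P_0)
    next
      case (Suc m)
      then show ?thesis by (simp add: L_def P_def card_periodic_pts del: of_nat_Suc)
    qed
  qed
  have "fps_deriv (xi_fps - xi_fps ^ 3) = fps_deriv fps_X"
    by (simp only: xi_fps_cubic)
  then have xi': "fps_deriv xi_fps * v = 1"
    by (simp add: v_def power2_eq_square power3_eq_cube algebra_simps)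
  have u': "fps_deriv u = - (1 + 4 * xi_fps) * fps_deriv xi_fps"
    by (simp add: u_def power2_eq_square algebra_simps)
  \<comment> \<open>The factor \<open>fps_X * v\<close> clears the denominators of \<open>(P - 1) / fps_X\<close> and of \<open>\<xi>' = 1 / v\<close>.\<close>
  have "fps_X * v * (fps_deriv L * u + 2 * fps_deriv u) = 0"
    using identity L xi' u' by Groebner_Basis.algebra
  moreover have "fps_X * v \<noteq> 0" using v_0 by auto
  ultimately have log_deriv: "fps_deriv L * u + 2 * fps_deriv u = 0" by simp
  have Z': "fps_deriv Z = Z * fps_deriv L"
    by (simp add: Z_def fps_compose_deriv L_def)
  have "fps_deriv (Z * (u * u)) = Z * u * (fps_deriv L * u + 2 * fps_deriv u)"
    by (simp add: Z' algebra_simps)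
  then have "fps_deriv (Z * (u * u)) = 0" by (simp add: log_deriv)
  then have "Z * (u * u) = fps_const ((Z * (u * u)) $ 0)"
    by (simp only: fps_deriv_eq_0_iff)
  then have "Z * (u * u) = 1" by (simp add: Z_def u_0)
  then have "inverse (u * u) = Z"
    by (intro fps_inverse_unique) (simp add: mult.commute)
  then show ?thesis by (simp add: Z_def L_def u_def zeta_series_def)
qed

theorem proposition5p2:
  shows "(\<lambda>z. 1 / (2 * (xi z)\<^sup>2 + xi z - 1)\<^sup>2)
           has_fps_expansion zeta_series (markov_dyck_shift A_G2)"
proof -
  let ?u = "1 - xi_fps - 2 * (xi_fps * xi_fps)"
  have "(\<lambda>z. inverse ((1 - xi z - 2 * (xi z * xi z)) * (1 - xi z - 2 * (xi z * xi z))))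
      has_fps_expansion inverse (?u * ?u)"
    by (intro has_fps_expansion_inverse fps_expansion_intros xi_has_fps_expansion) simp
  moreover have "inverse ((1 - xi z - 2 * (xi z * xi z)) * (1 - xi z - 2 * (xi z * xi z)))
      = 1 / (2 * (xi z)\<^sup>2 + xi z - 1)\<^sup>2" for z
  proof -
    have "(1 - xi z - 2 * (xi z * xi z)) * (1 - xi z - 2 * (xi z * xi z))
        = (2 * (xi z)\<^sup>2 + xi z - 1)\<^sup>2"
      by (simp add: power2_eq_square algebra_simps)
    then show ?thesis by (simp add: inverse_eq_divide)
  qed
  ultimately show ?thesis by (simp add: zeta_series_eq power2_eq_square)
qed

end
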